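(* Let $m$ be an odd positive integer with $m\not\equiv 1 \pmod 3$, such that $m(m+1)$ is not divisible by the square of any odd prime and $m+1$ is not a multiple of $8$. Let $d=(2m+1)^2-2$. If there exists a tight spherical $5$-design in $\mathbb{R}^d$ (i.e. in $\mathbb{S}^{d-1}$), then it is not of minimal type.
   Context: Spherical $5$-design: a finite non-empty $D\subset\mathbb{S}^{d-1}$ with $\int_{\mathbb{S}^{d-1}}f\,d\mu=\frac{1}{|D|}\sum_{x\in D}f(x)$ for all polynomials $f$ of degree $\le 5$ ($\mu$ normalized surface measure); it is tight if $|D|=d(d+1)$. A spherical $5$-design $D\subset\mathbb{S}^{d-1}$ is of minimal type if there is $\alpha\in\mathbb{R}^d$ with $\langle\alpha,x\rangle\in\{0,\pm1\}$ for all $x\in D$. *)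

theory Defs
  imports "HOL-Probability.Probability" "HOL-Number_Theory.Cong"
begin

text \<open>
  Normalized surface measure on the unit sphere: the surface measure of \<open>A\<close> is proportional to
  the volume of the cone \<open>{r x | 0 < r < 1, x \<in> A}\<close>, i.e. it is the push-forward of the uniform
  distribution on the unit ball under the radial projection \<open>sgn x = x / norm x\<close>.  The lemmas
  below show that it is the rotation invariant probability measure carried by the sphere.  It is
  a measure on the whole space (concentrated on the sphere), not a measure with space
  \<open>sphere 0 1\<close>.  The sort \<open>wellorder\<close> in the invariance lemma is inherited from the library's
  \<open>measure_orthogonal_image\<close>; the definition itself does not need it.
\<close>

definition sphere_measure :: "(real ^ 'n) measure" where
  "sphere_measure = distr (uniform_measure lborel (ball 0 1)) borel sgn"

lemma unit_ball_emeasure: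
  "emeasure lborel (ball (0 :: real ^ 'n) 1) \<noteq> 0"
  "emeasure lborel (ball (0 :: real ^ 'n) 1) \<noteq> \<infinity>"
proof -
  have "\<not> (ball (0 :: real ^ 'n) 1 \<in> null_sets lborel)"
    using open_not_negligible[of "ball (0 :: real ^ 'n) 1"]
    by (auto simp: negligible_iff_null_sets null_sets_completionI)
  then show "emeasure lborel (ball (0 :: real ^ 'n) 1) \<noteq> 0"
    by (simp add: null_sets_def)
  show "emeasure lborel (ball (0 :: real ^ 'n) 1) \<noteq> \<infinity>"
    using emeasure_bounded_finite[of "ball (0 :: real ^ 'n) 1"] by simp
qed

lemma sets_sphere_measure [simp, measurable_cong]: "sets sphere_measure = sets borel"
  by (simp add: sphere_measure_def)

lemma emeasure_sphere_measure:
  fixes A :: "(real ^ 'n) set"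
  assumes "A \<in> sets borel"
  shows "emeasure sphere_measure A
    = emeasure lborel (ball 0 1 \<inter> sgn -` A) / emeasure lborel (ball (0 :: real ^ 'n) 1)"
proof -
  have "sgn \<in> borel_measurable (uniform_measure lborel (ball (0 :: real ^ 'n) 1))"
    by simp
  moreover have "sgn -` A \<in> sets (borel :: (real ^ 'n) measure)"
    using measurable_sets[OF borel_measurable_sgn assms] by simp
  ultimately show ?thesis
    using assms by (simp add: sphere_measure_def emeasure_distr emeasure_uniform_measure)
qed

lemma prob_space_sphere_measure: "prob_space (sphere_measure :: (real ^ 'n) measure)"
  unfolding sphere_measure_def
  by (intro prob_space.prob_space_distr prob_space_uniform_measure)
     (use unit_ball_emeasure[where 'n = 'n] in auto)

lemma AE_sphere_measure: "AE x in (sphere_measure :: (real ^ 'n) measure). x \<in> sphere 0 1"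
proof (rule AE_I)
  have "sgn -` (- sphere 0 1) \<subseteq> {0 :: real ^ 'n}"
    by (auto simp: norm_sgn split: if_splits)
  then have "ball 0 1 \<inter> sgn -` (- sphere 0 1) \<subseteq> {0 :: real ^ 'n}"
    by blast
  then have "emeasure lborel (ball 0 1 \<inter> sgn -` (- sphere 0 1) :: (real ^ 'n) set) = 0"
    using emeasure_mono[of _ "{0 :: real ^ 'n}" lborel] by fastforce
  then show "emeasure sphere_measure (- sphere 0 1 :: (real ^ 'n) set) = 0"
    by (subst emeasure_sphere_measure) auto
qed auto

lemma sphere_measure_rotation_invariant:
  fixes f :: "real ^ 'n :: {finite, wellorder} \<Rightarrow> real ^ 'n :: _"
  assumes f: "orthogonal_transformation f"
  shows "distr sphere_measure borel f = sphere_measure"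
proof (rule measure_eqI)
  fix A :: "(real ^ 'n :: _) set"
  assume "A \<in> sets (distr sphere_measure borel f)"
  then have A: "A \<in> sets borel" by simp
  have lin: "linear f" and nf: "\<And>x. norm (f x) = norm x"
    using f by (auto simp: orthogonal_transformation)
  have mf: "f \<in> borel_measurable borel"
    using lin linear_continuous_on linear_conv_bounded_linear
    by (blast intro: borel_measurable_continuous_onI)
  then have fA: "f -` A \<in> sets borel"
    using measurable_sets[OF mf A] by simp
  define B where "B = ball 0 1 \<inter> sgn -` A"
  have B: "B \<in> sets borel"
    using measurable_sets[OF borel_measurable_sgn A] by (auto simp: B_def)
  have bB: "bounded B" by (auto simp: B_def)
  have eq: "ball 0 1 \<inter> sgn -` (f -` A) = f -` B"
    by (auto simp: B_def nf sgn_div_norm linear_cmul[OF lin])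
  have im: "f -` B = inv f ` B"
    using f by (simp add: bij_vimage_eq_inv_image orthogonal_transformation_bij)
  have LB: "B \<in> lmeasurable"
    using bB B by (intro bounded_set_imp_lmeasurable) (auto intro: sets_completionI_sets)
  have fB: "f -` B \<in> sets borel"
    using measurable_sets[OF mf B] by simp
  have "measure lebesgue (f -` B) = measure lebesgue B" "f -` B \<in> lmeasurable"
    unfolding im using LB f
    by (auto intro!: measure_orthogonal_image measurable_orthogonal_image
        orthogonal_transformation_inv)
  then have "emeasure lebesgue (f -` B) = emeasure lebesgue B"
    using LB by (simp add: emeasure_eq_measure2 fmeasurableD2)
  then have "emeasure lborel (f -` B) = emeasure lborel B"
    using B fB by (simp add: emeasure_completion)
  then show "emeasure (distr sphere_measure borel f) A = emeasure sphere_measure A"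
    using A fA mf by (simp add: emeasure_distr emeasure_sphere_measure eq B_def)
qed simp

definition polynomials_of_degree_le :: "nat \<Rightarrow> (real ^ 'n \<Rightarrow> real) set" where
  "polynomials_of_degree_le k =
    {f. \<exists>c :: ('n \<Rightarrow> nat) \<Rightarrow> real.
       f = (\<lambda>x. \<Sum>e | (\<Sum>i\<in>UNIV. e i) \<le> k. c e * (\<Prod>i\<in>UNIV. (x $ i) ^ e i))}"

text \<open>The sum above is a genuine one: there are only finitely many exponent vectors.\<close>

lemma finite_exponents: "finite {e :: 'n::finite \<Rightarrow> nat. (\<Sum>i\<in>UNIV. e i) \<le> k}"
proof (rule finite_subset)
  have "e i \<le> k" if "(\<Sum>i\<in>UNIV. e i) \<le> k" for e :: "'n \<Rightarrow> nat" and i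
    using that member_le_sum[of i UNIV e] by simp
  then show "{e :: 'n \<Rightarrow> nat. (\<Sum>i\<in>UNIV. e i) \<le> k} \<subseteq> UNIV \<rightarrow>\<^sub>E {..k}"
    by auto
qed (simp add: finite_PiE)

definition spherical_design :: "nat \<Rightarrow> (real ^ 'n) set \<Rightarrow> bool" where
  "spherical_design t D \<longleftrightarrow>
     finite D \<and> D \<noteq> {} \<and> D \<subseteq> sphere 0 1 \<and>
     (\<forall>f \<in> polynomials_of_degree_le t.
        (\<integral>x. f x \<partial>sphere_measure) = (\<Sum>x\<in>D. f x) / real (card D))"

definition tight_spherical_5_design :: "(real ^ 'n) set \<Rightarrow> bool" where
  "tight_spherical_5_design D \<longleftrightarrow>
     spherical_design 5 D \<and> card D = CARD('n) * (CARD('n) + 1)"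

text \<open>
  The vector \<open>\<alpha>\<close> is required to be non-zero, since \<open>\<alpha> = 0\<close> would make every design of minimal
  type.
\<close>

definition minimal_type :: "(real ^ 'n) set \<Rightarrow> bool" where
  "minimal_type D \<longleftrightarrow> spherical_design 5 D \<and> (\<exists>\<alpha>. \<alpha> \<noteq> 0 \<and> (\<forall>x\<in>D. \<alpha> \<bullet> x \<in> {0, 1, -1}))"

end

theory Submission
  imports Defs
begin

text \<open>
  Put \<open>s = 2 m + 1\<close>, \<open>h = m (m + 1)\<close> and \<open>d + 2 = s\<^sup>2\<close>.  Tightness forces the inner products of the
  design \<open>D\<close> to be \<open>\<plusminus> 1\<close> and \<open>\<plusminus> 1/s\<close>, so the vectors \<open>(sqrt s x, 1) / sqrt 2\<close>, \<open>x \<in> D\<close>, span an even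
  integral lattice \<open>K\<close> of rank \<open>d + 1 = 4 h\<close>.  If \<open>\<beta>\<close> takes integral values \<open>t\<close> on \<open>D\<close>, then the
  second and fourth moments of the design and \<open>12 dvd t\<^sup>4 - t\<^sup>2\<close> give
  \<open>h w (w - s) \<in> 18 \<int>\<close> for \<open>w = 3 (\<beta> \<bullet> \<beta>) / s\<close>; as \<open>h\<close> is almost squarefree, \<open>w\<close> is an integer
  congruent to \<open>0\<close> or \<open>s\<close> modulo \<open>3\<close>.  Hence the discriminant group of \<open>K\<close> is trivial or cyclic of
  order \<open>3\<close>.  An even lattice of rank divisible by \<open>4\<close> and odd determinant has determinant
  \<open>1\<close> modulo \<open>4\<close>, so \<open>K\<close> is unimodular.  A vector \<open>\<gamma>\<close> with \<open>\<gamma> \<bullet> x \<in> {0, \<plusminus> 1}\<close> on \<open>D\<close> would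
  give an element of the dual lattice of norm \<open>2 s / 3\<close>, which is not an integer.
\<close>

section \<open>Moments of the surface measure\<close>

text \<open>The uniqueness argument for Haar measure: Fubini for \<open>M\<close> times
  \<open>lborel\<close>, with the substitutions \<open>y := y - x\<close>, then
  \<open>x := x + y\<close>, then a translation of \<open>y\<close>. A \<open>B\<close> of positive
  finite volume then shows that \<open>M\<close> is a multiple of \<open>lborel\<close>.\<close>

lemma translation_invariant_measure_swap:
  fixes M :: "'a::euclidean_space measure"
  assumes sets: "sets M = sets borel" and "sigma_finite_measure M"
    and inv: "\<And>a. distr M borel ((+) a) = M"
    and A: "A \<in> sets borel" and B: "B \<in> sets borel"
  shows "emeasure M A * emeasure lborel B = emeasure lborel A * emeasure M (uminus -` B)"
proof -
  interpret M: sigma_finite_measure M by fact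
  interpret P: pair_sigma_finite M "lborel :: 'a measure" ..
  note [measurable] = A B
  note [measurable_cong] = sets
  have [measurable]: "uminus -` B \<in> sets borel"
    using measurable_sets[OF borel_measurable_uminus[OF measurable_ident_sets[OF refl]] B] by simp
  have tL: "(\<integral>\<^sup>+y. g y \<partial>lborel) = (\<integral>\<^sup>+y. g (a + y) \<partial>lborel)"
    if [measurable]: "g \<in> borel_measurable borel" for g :: "'a \<Rightarrow> ennreal" and a
    by (subst lborel_distr_plus[of a, symmetric]) (simp add: nn_integral_distr)
  have tM: "(\<integral>\<^sup>+y. g y \<partial>M) = (\<integral>\<^sup>+y. g (a + y) \<partial>M)"
    if [measurable]: "g \<in> borel_measurable borel" for g :: "'a \<Rightarrow> ennreal" and a
    by (subst inv[of a, symmetric]) (simp add: nn_integral_distr)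
  have "emeasure M A * emeasure lborel B = (\<integral>\<^sup>+x. \<integral>\<^sup>+y. indicator A x * indicator B y \<partial>lborel \<partial>M)"
    using sets by (simp add: nn_integral_cmult nn_integral_multc A B)
  also have "\<dots> = (\<integral>\<^sup>+x. \<integral>\<^sup>+y. indicator A x * indicator B (- x + y) \<partial>lborel \<partial>M)"
    by (intro nn_integral_cong tL) measurable
  also have "\<dots> = (\<integral>\<^sup>+y. \<integral>\<^sup>+x. indicator A x * indicator B (- x + y) \<partial>M \<partial>lborel)"
    by (rule P.Fubini'[symmetric]) measurable
  also have "\<dots> = (\<integral>\<^sup>+y. \<integral>\<^sup>+x. indicator A (y + x) * indicator B (- (y + x) + y) \<partial>M \<partial>lborel)"
    by (intro nn_integral_cong tM) measurable
  also have "\<dots> = (\<integral>\<^sup>+y. \<integral>\<^sup>+x. indicator A (x + y) * indicator B (- x) \<partial>M \<partial>lborel)"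
    by (simp add: add.commute)
  also have "\<dots> = (\<integral>\<^sup>+x. \<integral>\<^sup>+y. indicator A (x + y) * indicator B (- x) \<partial>lborel \<partial>M)"
    by (rule P.Fubini') measurable
  also have "\<dots> = (\<integral>\<^sup>+x. \<integral>\<^sup>+y. indicator A y * indicator B (- x) \<partial>lborel \<partial>M)"
    by (intro nn_integral_cong tL[symmetric]) measurable
  also have "\<dots> = (\<integral>\<^sup>+x. \<integral>\<^sup>+y. indicator A y * indicator (uminus -` B) x \<partial>lborel \<partial>M)"
    by (simp add: indicator_def vimage_def)
  also have "\<dots> = emeasure lborel A * emeasure M (uminus -` B)"
    using sets by (simp add: nn_integral_cmult nn_integral_multc A B)
  finally show ?thesis .
qed

lemma borel_measurable_orthogonal_transformation:
  fixes f :: "real^'n \<Rightarrow> real^'n"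
  assumes "orthogonal_transformation f"
  shows "f \<in> borel_measurable borel"
  using assms linear_continuous_on linear_conv_bounded_linear
  by (auto simp: orthogonal_transformation intro!: borel_measurable_continuous_onI)

text \<open>The image measure is again translation invariant, hence proportional to
  \<open>lborel\<close>; the factor is 1 because the unit ball is preserved by \<open>f\<close> and
  by negation. This covers every finite index type, without the sort
  \<open>wellorder\<close>.\<close>

lemma lborel_distr_orthogonal:
  fixes f :: "real^'n \<Rightarrow> real^'n"
  assumes f: "orthogonal_transformation f"
  shows "distr lborel borel f = lborel"
proof (rule measure_eqI)
  fix A :: "(real^'n) set" assume "A \<in> sets (distr lborel borel f)"
  then have A: "A \<in> sets borel" by simp
  have lin: "linear f" and nf: "\<And>x. norm (f x) = norm x"
    using f by (auto simp: orthogonal_transformation)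
  have mf [measurable]: "f \<in> borel_measurable borel"
    by (rule borel_measurable_orthogonal_transformation[OF f])
  obtain g where g: "orthogonal_transformation g" "\<And>x. f (g x) = x" "\<And>x. g (f x) = x"
    using orthogonal_transformation_bij[OF f] orthogonal_transformation_inv[OF f]
    by (metis bij_inv_eq_iff)
  have mg [measurable]: "g \<in> borel_measurable borel"
    by (rule borel_measurable_orthogonal_transformation[OF g(1)])
  let ?M = "distr lborel borel f"
  have "emeasure ?M A * emeasure lborel (ball (0::real^'n) 1)
      = emeasure lborel A * emeasure ?M (uminus -` ball 0 1)"
  proof (rule translation_invariant_measure_swap)
    have vol: "emeasure ?M (ball 0 r) = emeasure lborel (ball (0::real^'n) r)" for r
      by (subst emeasure_distr) (auto simp: vimage_def nf ball_def)
    show "sigma_finite_measure ?M"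
    proof (unfold_locales, intro exI conjI ballI)
      show "countable (range (\<lambda>k. ball (0::real^'n) (real k)))" by simp
      show "\<Union> (range (\<lambda>k. ball (0::real^'n) (real k))) = space ?M"
        using reals_Archimedean2 by auto
      show "emeasure ?M a \<noteq> \<infinity>" if "a \<in> range (\<lambda>k. ball (0::real^'n) (real k))" for a
        using that emeasure_bounded_finite[of "ball (0::real^'n) _"] vol
        by (auto simp: less_top[symmetric])
    qed auto
    show "distr ?M borel ((+) a) = ?M" for a
    proof -
      \<comment> \<open>Translation by \<open>a\<close> after \<open>f\<close> is translation by the
        preimage \<open>g a\<close> before \<open>f\<close>.\<close>
      have "(+) a \<circ> f = f \<circ> (+) (g a)"
        using g lin by (auto simp: fun_eq_iff linear_add)
      then have "distr ?M borel ((+) a) = distr (distr lborel borel ((+) (g a))) borel f"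
        by (simp add: distr_distr)
      then show ?thesis by (simp add: lborel_distr_plus)
    qed
  qed (use A in auto)
  also have "emeasure ?M (uminus -` ball 0 1) = emeasure lborel (ball (0::real^'n) 1)"
    by (subst emeasure_distr) (auto simp: vimage_def nf ball_def)
  finally show "emeasure ?M A = emeasure lborel A"
    using unit_ball_emeasure[where 'n='n]
    by (metis ennreal_mult_divide_eq infinity_ennreal_def)
qed simp

lemma sphere_measure_distr_orthogonal:
  fixes f :: "real^'n \<Rightarrow> real^'n"
  assumes f: "orthogonal_transformation f"
  shows "distr sphere_measure borel f = sphere_measure"
proof -
  let ?U = "uniform_measure lborel (ball (0::real^'n) 1)"
  have lin: "linear f" and nf: "\<And>x. norm (f x) = norm x"
    using f by (auto simp: orthogonal_transformation)
  have mf [measurable]: "f \<in> borel_measurable borel"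
    by (rule borel_measurable_orthogonal_transformation[OF f])
  have "distr ?U borel f = ?U"
  proof (rule measure_eqI)
    fix A assume "A \<in> sets (distr ?U borel f)"
    then have A[measurable]: "A \<in> sets borel" by simp
    have fA: "f -` A \<in> sets borel" using measurable_sets[OF mf A] by simp
    have "ball 0 1 \<inter> f -` A = f -` (ball 0 1 \<inter> A)" by (auto simp: nf)
    also have "emeasure lborel \<dots> = emeasure lborel (ball 0 1 \<inter> A)"
      by (subst (2) lborel_distr_orthogonal[OF f, symmetric]) (simp add: emeasure_distr)
    finally show "emeasure (distr ?U borel f) A = emeasure ?U A"
      using fA by (simp add: emeasure_distr emeasure_uniform_measure)
  qed simp
  moreover have "f \<circ> sgn = sgn \<circ> f"
    by (auto simp: nf sgn_div_norm linear_cmul[OF lin])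
  then have "distr sphere_measure borel f = distr (distr ?U borel f) borel sgn"
    by (simp add: sphere_measure_def distr_distr)
  ultimately show ?thesis by (simp add: sphere_measure_def)
qed

lemma sphere_measure_integral_orthogonal:
  fixes g :: "real^'n \<Rightarrow> real" and f :: "real^'n \<Rightarrow> real^'n"
  assumes f: "orthogonal_transformation f" and [measurable]: "g \<in> borel_measurable borel"
  shows "(\<integral>y. g (f y) \<partial>sphere_measure) = (\<integral>y. g y \<partial>sphere_measure)"
proof -
  have [measurable]: "f \<in> borel_measurable borel"
    by (rule borel_measurable_orthogonal_transformation[OF f])
  show ?thesis
    by (subst (2) sphere_measure_distr_orthogonal[OF f, symmetric]) (simp add: integral_distr)
qed

lemma integrable_sphere_measure:
  fixes g :: "real^'n \<Rightarrow> real"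
  assumes "continuous_on UNIV g"
  shows "integrable sphere_measure g"
proof -
  interpret prob_space "sphere_measure :: (real^'n) measure"
    by (rule prob_space_sphere_measure)
  have [measurable]: "g \<in> borel_measurable borel"
    using assms by (rule borel_measurable_continuous_onI)
  have "compact (g ` sphere 0 1)"
    using assms by (intro compact_continuous_image) (auto intro: continuous_on_subset)
  then obtain C where C: "\<And>x. x \<in> sphere 0 1 \<Longrightarrow> norm (g x) \<le> C"
    using bounded_iff compact_imp_bounded by (metis image_eqI)
  have "AE x in (sphere_measure :: (real^'n) measure). norm (g x) \<le> C"
    using AE_sphere_measure by eventually_elim (rule C)
  then show ?thesis
    by (intro integrable_const_bound) auto
qed

text \<open>A rotation carries \<open>norm a *\<^sub>R b\<close> to \<open>a\<close>, so the moment
  depends on the length of \<open>a\<close> only. Each moment is thereby reduced to a single unknown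
  constant.\<close>

lemma sphere_measure_inner_power:
  fixes a b :: "real^'n"
  assumes "norm b = 1"
  shows "(\<integral>y. (a \<bullet> y)^k \<partial>sphere_measure) = norm a ^ k * (\<integral>y. (b \<bullet> y)^k \<partial>sphere_measure)"
proof -
  obtain f where f: "orthogonal_transformation f" "f (norm a *\<^sub>R b) = a"
    by (rule orthogonal_transformation_exists[of "norm a *\<^sub>R b" a]) (use assms in auto)
  have "(\<integral>y. (a \<bullet> y)^k \<partial>sphere_measure) = (\<integral>y. (a \<bullet> f y)^k \<partial>sphere_measure)"
    by (rule sphere_measure_integral_orthogonal[OF f(1), symmetric])
       (intro borel_measurable_continuous_onI continuous_intros)
  also have "\<dots> = (\<integral>y. (norm a * (b \<bullet> y))^k \<partial>sphere_measure)"
  proof -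
    have "a \<bullet> f y = norm a * (b \<bullet> y)" for y
    proof -
      have "a \<bullet> f y = f (norm a *\<^sub>R b) \<bullet> f y" by (simp only: f(2))
      also have "\<dots> = (norm a *\<^sub>R b) \<bullet> y"
        using f(1) unfolding orthogonal_transformation_def by blast
      finally show ?thesis by simp
    qed
    then show ?thesis by simp
  qed
  finally show ?thesis by (simp add: power_mult_distrib)
qed

text \<open>Since \<open>a\<close> and \<open>- a\<close> have the same length, the moment is even
  in \<open>a\<close>; for odd \<open>k\<close> it is also odd in \<open>a\<close>.\<close>

lemma sphere_measure_inner_power_odd:
  fixes a :: "real^'n"
  assumes "odd k"
  shows "(\<integral>y. (a \<bullet> y)^k \<partial>sphere_measure) = 0"
proof -
  obtain b :: "real^'n" where b: "norm b = 1" by (metis norm_axis_1)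
  have "(\<integral>y. (a \<bullet> y)^k \<partial>sphere_measure) = (\<integral>y. ((- a) \<bullet> y)^k \<partial>sphere_measure)"
    using sphere_measure_inner_power[OF b, of a k] sphere_measure_inner_power[OF b, of "- a" k]
    by (simp only: norm_minus_cancel)
  then show ?thesis using assms by (simp add: power_minus_odd)
qed

lemma sum_inner_axis_squared:
  "(\<Sum>i\<in>UNIV. (axis i 1 \<bullet> y)^2) = (norm y)^2" for y :: "real^'n"
  unfolding power2_norm_eq_inner by (simp add: inner_axis' inner_vec_def[of y y] power2_eq_square)

text \<open>Almost everywhere the squared coordinates add up to 1, and all of them have the same
  integral.\<close>

lemma sphere_measure_moment2:
  fixes a :: "real^'n"
  shows "(\<integral>y. (a \<bullet> y)^2 \<partial>sphere_measure) = (norm a)^2 / CARD('n)"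
proof -
  interpret prob_space "sphere_measure :: (real^'n) measure"
    by (rule prob_space_sphere_measure)
  obtain b :: "real^'n" where b: "norm b = 1" by (metis norm_axis_1)
  define c where "c = (\<integral>y. (b \<bullet> y)^2 \<partial>sphere_measure)"
  have c: "(\<integral>y. (a \<bullet> y)^2 \<partial>sphere_measure) = norm a ^ 2 * c" for a :: "real^'n"
    unfolding c_def by (rule sphere_measure_inner_power[OF b])
  have "(\<integral>y. 1 \<partial>(sphere_measure :: (real^'n) measure)) = (\<integral>y. (\<Sum>i\<in>(UNIV::'n set). (axis i 1 \<bullet> y)^2) \<partial>sphere_measure)"
  proof (rule integral_cong_AE)
    show "(\<lambda>y::real^'n. \<Sum>i\<in>UNIV. (axis i 1 \<bullet> y)^2) \<in> borel_measurable sphere_measure"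
      by (intro borel_measurable_integrable integrable_sphere_measure continuous_intros)
    show "AE y in sphere_measure. 1 = (\<Sum>i\<in>UNIV. (axis i 1 \<bullet> (y::real^'n))^2)"
      using AE_sphere_measure
      by eventually_elim (simp add: sum_inner_axis_squared)
  qed simp
  also have "\<dots> = (\<Sum>i\<in>(UNIV::'n set). c)"
    by (subst Bochner_Integration.integral_sum)
       (auto intro!: integrable_sphere_measure continuous_intros sum.cong
         simp: c)
  finally have "c = 1 / CARD('n)" by (simp add: prob_space field_simps)
  then show ?thesis by (simp add: c)
qed

text \<open>The constant is found by integrating the square of the sum of the squared coordinates,
  which is 1 almost everywhere. Its mixed terms come from \<open>(u + v)^4 + (u - v)^4\<close>,
  applied to two coordinate axes.\<close>

lemma sphere_measure_moment4:
  fixes a :: "real^'n"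
  shows "(\<integral>y. (a \<bullet> y)^4 \<partial>sphere_measure) = 3 * (norm a)^4 / (CARD('n) * (CARD('n) + 2))"
proof -
  interpret prob_space "sphere_measure :: (real^'n) measure"
    by (rule prob_space_sphere_measure)
  obtain b :: "real^'n" where b: "norm b = 1" by (metis norm_axis_1)
  define c where "c = (\<integral>y. (b \<bullet> y)^4 \<partial>sphere_measure)"
  let ?d = "real CARD('n)"
  have c: "(\<integral>y. (a \<bullet> y)^4 \<partial>sphere_measure) = norm a ^ 4 * c" for a :: "real^'n"
    unfolding c_def by (rule sphere_measure_inner_power[OF b])
  have mixed: "(\<integral>y. (axis i 1 \<bullet> y)^2 * (axis j 1 \<bullet> y)^2 \<partial>sphere_measure) = (if i = j then c else c / 3)"
    (is "?I = _") for i j :: 'n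
  proof (cases "i = j")
    case True
    have "u^2 * u^2 = u^4" for u :: real by (simp add: power4_eq_xxxx power2_eq_square)
    then have "?I = (\<integral>y. (axis i 1 \<bullet> y)^4 \<partial>sphere_measure)"
      using True by (simp only:)
    also have "\<dots> = c" by (simp add: c)
    finally show ?thesis using True by simp
  next
    case False
    let ?p = "axis i 1 :: real^'n" and ?q = "axis j 1 :: real^'n"
    have n: "norm (?p + ?q) ^ 4 = 4" "norm (?p - ?q) ^ 4 = 4"
    proof -
      have "norm (?p + ?q) ^ 2 = 2" "norm (?p - ?q) ^ 2 = 2"
        using False unfolding power2_norm_eq_inner
        by (auto simp: inner_add_left inner_add_right inner_diff_left inner_diff_right inner_axis_axis)
      moreover have "norm (?p + ?q) ^ 4 = (norm (?p + ?q) ^ 2)^2" "norm (?p - ?q) ^ 4 = (norm (?p - ?q) ^ 2)^2"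
        by simp_all
      ultimately show "norm (?p + ?q) ^ 4 = 4" "norm (?p - ?q) ^ 4 = 4"
        by (simp_all only:) simp_all
    qed
    have binom: "(u + v)^4 + (u - v)^4 = (2 * u^4 + 2 * v^4) + 12 * (u^2 * v^2)" for u v :: real
      by (simp add: power4_eq_xxxx power2_eq_square algebra_simps)
    have int: "integrable sphere_measure (\<lambda>y. (?p \<bullet> y)^4)" "integrable sphere_measure (\<lambda>y. (?q \<bullet> y)^4)"
      "integrable sphere_measure (\<lambda>y. (?p \<bullet> y)^2 * (?q \<bullet> y)^2)"
      by (intro integrable_sphere_measure continuous_intros)+
    \<comment> \<open>Both \<open>?p + ?q\<close> and \<open>?p - ?q\<close> have length
      \<open>sqrt 2\<close>, whose fourth power is 4.\<close>
    have "4 * c + 4 * c = (\<integral>y. ((?p + ?q) \<bullet> y)^4 + ((?p - ?q) \<bullet> y)^4 \<partial>sphere_measure)"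
      by (subst Bochner_Integration.integral_add)
         (auto intro!: integrable_sphere_measure continuous_intros simp: c n)
    also have "\<dots> = (\<integral>y. (2 * (?p \<bullet> y)^4 + 2 * (?q \<bullet> y)^4) + 12 * ((?p \<bullet> y)^2 * (?q \<bullet> y)^2) \<partial>sphere_measure)"
      by (simp only: inner_add_left inner_diff_left binom)
    also have "\<dots> = (2 * c + 2 * c) + 12 * ?I"
      using int by (simp add: c)
    finally show ?thesis using False by simp
  qed
  have int2: "integrable sphere_measure (\<lambda>y. (axis i 1 \<bullet> y)^2 * (axis j 1 \<bullet> y)^2)" for i j :: 'n
    by (intro integrable_sphere_measure continuous_intros)
  have "(\<integral>y. 1 \<partial>(sphere_measure :: (real^'n) measure)) = (\<integral>y. (\<Sum>i\<in>(UNIV::'n set). \<Sum>j\<in>(UNIV::'n set). (axis i 1 \<bullet> y)^2 * (axis j 1 \<bullet> y)^2) \<partial>sphere_measure)"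
  proof (rule integral_cong_AE)
    show "(\<lambda>y::real^'n. \<Sum>i\<in>UNIV. \<Sum>j\<in>UNIV. (axis i 1 \<bullet> y)^2 * (axis j 1 \<bullet> y)^2) \<in> borel_measurable sphere_measure"
      by (intro borel_measurable_integrable integrable_sphere_measure continuous_intros)
    show "AE y in sphere_measure. 1 = (\<Sum>i\<in>UNIV. \<Sum>j\<in>UNIV. (axis i 1 \<bullet> (y::real^'n))^2 * (axis j 1 \<bullet> y)^2)"
      using AE_sphere_measure
      by eventually_elim
        (simp add: sum_inner_axis_squared sum_distrib_left[symmetric] sum_distrib_right[symmetric])
  qed simp
  also have "\<dots> = (\<Sum>i\<in>UNIV. \<Sum>j\<in>UNIV. (if i = (j::'n) then c else c / 3))"
    by (simp add: int2 mixed)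
  also have "\<dots> = (\<Sum>i\<in>(UNIV::'n set). \<Sum>j\<in>(UNIV::'n set). c / 3 + (if i = j then 2 * c / 3 else 0))"
    by (intro sum.cong) auto
  also have "\<dots> = ?d * ((?d + 2) * c / 3)"
    by (simp add: sum.distrib) (simp add: field_simps)
  finally have "c * (?d * (?d + 2)) = 3" by (simp add: prob_space algebra_simps)
  moreover have "?d * (?d + 2) \<noteq> 0" by (simp add: add_nonneg_eq_0_iff)
  ultimately have "c = 3 / (?d * (?d + 2))" by (simp only: eq_divide_eq if_True if_False simp_thms)
  then show ?thesis by (simp add: c algebra_simps)
qed

section \<open>Tight designs\<close>

lemma monomial_in_polynomials:
  fixes e :: "'n::finite \<Rightarrow> nat"
  assumes "(\<Sum>i\<in>UNIV. e i) \<le> k"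
  shows "(\<lambda>x::real^'n. \<Prod>i\<in>UNIV. (x $ i) ^ e i) \<in> polynomials_of_degree_le k"
  unfolding polynomials_of_degree_le_def
proof (intro CollectI exI ext)
  fix x :: "real^'n"
  have "(\<Sum>e' | (\<Sum>i\<in>UNIV. e' i) \<le> k. of_bool (e' = e) * (\<Prod>i\<in>UNIV. (x $ i) ^ e' i))
      = (\<Sum>e' \<in> {e}. of_bool (e' = e) * (\<Prod>i\<in>UNIV. (x $ i) ^ e' i))"
    using assms by (intro sum.mono_neutral_right finite_exponents) auto
  then show "(\<Prod>i\<in>UNIV. (x $ i) ^ e i)
      = (\<Sum>e' | (\<Sum>i\<in>UNIV. e' i) \<le> k. of_bool (e' = e) * (\<Prod>i\<in>UNIV. (x $ i) ^ e' i))"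
    by simp
qed

lemma sum_in_polynomials:
  fixes f :: "'a \<Rightarrow> real^'n \<Rightarrow> real"
  assumes "finite A" "\<And>a. a \<in> A \<Longrightarrow> f a \<in> polynomials_of_degree_le k"
  shows "(\<lambda>x. \<Sum>a\<in>A. c a * f a x) \<in> polynomials_of_degree_le k"
proof -
  have ex: "\<forall>a\<in>A. \<exists>C. f a = (\<lambda>x. \<Sum>e | (\<Sum>i\<in>UNIV. e i) \<le> k. C e * (\<Prod>i\<in>UNIV. (x $ i) ^ e i))"
    using assms(2) by (auto simp: polynomials_of_degree_le_def)
  obtain C where C: "\<forall>a\<in>A. f a = (\<lambda>x. \<Sum>e | (\<Sum>i\<in>UNIV. e i) \<le> k. C a e * (\<Prod>i\<in>UNIV. (x $ i) ^ e i))"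
    using bchoice[OF ex] by blast
  have "(\<lambda>x. \<Sum>a\<in>A. c a * f a x)
      = (\<lambda>x. \<Sum>e | (\<Sum>i\<in>UNIV. e i) \<le> k. (\<Sum>a\<in>A. c a * C a e) * (\<Prod>i\<in>UNIV. (x $ i) ^ e i))"
  proof
    fix x
    have "(\<Sum>a\<in>A. c a * f a x)
        = (\<Sum>a\<in>A. \<Sum>e | (\<Sum>i\<in>UNIV. e i) \<le> k. c a * C a e * (\<Prod>i\<in>UNIV. (x $ i) ^ e i))"
      by (intro sum.cong refl) (simp add: bspec[OF C] sum_distrib_left mult.assoc)
    then show "(\<Sum>a\<in>A. c a * f a x)
        = (\<Sum>e | (\<Sum>i\<in>UNIV. e i) \<le> k. (\<Sum>a\<in>A. c a * C a e) * (\<Prod>i\<in>UNIV. (x $ i) ^ e i))"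
      by (subst (asm) sum.swap) (simp add: sum_distrib_right)
  qed
  then show ?thesis
    unfolding polynomials_of_degree_le_def by (intro CollectI exI)
qed

lemma inner_power_in_polynomials:
  fixes a :: "real^'n"
  assumes "k \<le> j"
  shows "(\<lambda>x. (a \<bullet> x)^k) \<in> polynomials_of_degree_le j"
  using assms
proof (induction k arbitrary: j)
  case 0
  show ?case using monomial_in_polynomials[of "\<lambda>_. 0"] by simp
next
  case (Suc k)
  then obtain j' where j: "j = Suc j'" "k \<le> j'" by (cases j) auto
  obtain c where c: "(\<lambda>x. (a \<bullet> x)^k)
      = (\<lambda>x. \<Sum>e | (\<Sum>i\<in>UNIV. e i) \<le> j'. c e * (\<Prod>i\<in>UNIV. (x $ i) ^ e i))"
    using Suc.IH[OF j(2)] by (auto simp: polynomials_of_degree_le_def)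
  let ?E = "{e :: 'n \<Rightarrow> nat. (\<Sum>i\<in>UNIV. e i) \<le> j'}"
  \<comment> \<open>\<open>?up e l\<close> is the exponent vector of the monomial \<open>e\<close>
    multiplied by the coordinate \<open>l\<close>.\<close>
  let ?up = "\<lambda>e (l::'n) i. e i + of_bool (i = l) :: nat"
  have up: "x $ l * (\<Prod>i\<in>UNIV. (x $ i) ^ e i) = (\<Prod>i\<in>UNIV. (x $ i) ^ ?up e l i)"
    for x :: "real^'n" and e l
  proof -
    have "(\<Prod>i\<in>UNIV. (x $ i) ^ of_bool (i = l)) = (\<Prod>i\<in>UNIV. if i = l then x $ i else 1)"
      by (intro prod.cong) auto
    then show ?thesis by (simp add: power_add prod.distrib)
  qed
  have "(\<lambda>x. (a \<bullet> x)^Suc k) = (\<lambda>x. \<Sum>p\<in>?E \<times> UNIV. (c (fst p) * a $ snd p) * (\<Prod>i\<in>UNIV. (x $ i) ^ ?up (fst p) (snd p) i))"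
  proof
    fix x
    have "(a \<bullet> x)^Suc k = (\<Sum>l\<in>UNIV. a $ l * x $ l) * (\<Sum>e\<in>?E. c e * (\<Prod>i\<in>UNIV. (x $ i) ^ e i))"
      using fun_cong[OF c, of x] by (simp add: inner_vec_def)
    also have "\<dots> = (\<Sum>e\<in>?E. \<Sum>l\<in>UNIV. (c e * a $ l) * (\<Prod>i\<in>UNIV. (x $ i) ^ ?up e l i))"
      by (simp add: sum_product up[symmetric] mult_ac) (rule sum.swap)
    finally show "(a \<bullet> x)^Suc k = (\<Sum>p\<in>?E \<times> UNIV. (c (fst p) * a $ snd p) * (\<Prod>i\<in>UNIV. (x $ i) ^ ?up (fst p) (snd p) i))"
      by (simp add: sum.cartesian_product case_prod_beta)
  qed
  also have "\<dots> \<in> polynomials_of_degree_le j"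
    by (intro sum_in_polynomials monomial_in_polynomials finite_cartesian_product finite_exponents)
       (auto simp: sum.distrib j(1))
  finally show ?case .
qed

lemma design_sum_inner_power:
  fixes D :: "(real^'n) set"
  assumes "spherical_design t D" "k \<le> t"
  shows "(\<Sum>x\<in>D. (a \<bullet> x)^k) = card D * (\<integral>y. (a \<bullet> y)^k \<partial>sphere_measure)"
proof -
  have "(\<integral>y. (a \<bullet> y)^k \<partial>sphere_measure) = (\<Sum>x\<in>D. (a \<bullet> x)^k) / card D"
    using assms inner_power_in_polynomials[of k t a] unfolding spherical_design_def by blast
  moreover have "card D \<noteq> 0" using assms(1) by (auto simp: spherical_design_def)
  ultimately show ?thesis by simp
qed

text \<open>The cardinality \<open>d * (d + 1)\<close> cancels the factor \<open>d\<close> in the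
  denominators of the moments. All later arguments use the averaging property of the design through
  these identities only.\<close>

lemma tight_design_sums:
  fixes D :: "(real^'n) set"
  assumes D: "tight_spherical_5_design D"
  shows "(\<Sum>x\<in>D. (a \<bullet> x)^2) = (real CARD('n) + 1) * (a \<bullet> a)"
    and "(\<Sum>x\<in>D. (a \<bullet> x)^4) = 3 * (real CARD('n) + 1) / (real CARD('n) + 2) * (a \<bullet> a)^2"
    and "\<lbrakk>odd k; k \<le> 5\<rbrakk> \<Longrightarrow> (\<Sum>x\<in>D. (a \<bullet> x)^k) = 0"
proof -
  have s: "spherical_design 5 D" and c: "real (card D) = CARD('n) * (real CARD('n) + 1)"
    using D by (auto simp: tight_spherical_5_design_def algebra_simps)
  have frac: "d * (d + 1) * (3 * N / (d * (d + 2))) = 3 * (d + 1) / (d + 2) * N" if "d > 0" for d N :: real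
    using that by (simp add: divide_simps)
  have "norm a ^ 4 = (norm a ^ 2)^2" by simp
  then have n: "norm a ^ 4 = (a \<bullet> a)^2" by (simp only: power2_norm_eq_inner)
  show "(\<Sum>x\<in>D. (a \<bullet> x)^2) = (real CARD('n) + 1) * (a \<bullet> a)"
    by (simp add: design_sum_inner_power[OF s] sphere_measure_moment2 c power2_norm_eq_inner field_simps)
  show "(\<Sum>x\<in>D. (a \<bullet> x)^4) = 3 * (real CARD('n) + 1) / (real CARD('n) + 2) * (a \<bullet> a)^2"
    unfolding design_sum_inner_power[OF s, of 4, simplified] sphere_measure_moment4 c n
    using frac[of "real CARD('n)"] by (simp only: of_nat_mult of_nat_add of_nat_numeral of_nat_0_less_iff zero_less_card_finite)
  show "(\<Sum>x\<in>D. (a \<bullet> x)^k) = 0" if "odd k" "k \<le> 5"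
    using design_sum_inner_power[OF s that(2)] sphere_measure_inner_power_odd[OF that(1), of a] by simp
qed

text \<open>
  The polynomials \<open>(t + 1) (t\<^sup>2 - 1/(d+2))\<^sup>2\<close> and \<open>t (t\<^sup>2 - 1/(d+2))\<^sup>2\<close> turn the tightness into
  equality in the linear programming bound: the first is nonnegative on \<open>[-1,1]\<close> and its value at
  \<open>1\<close> already exhausts the design average.
\<close>

lemma tight_design_structure:
  fixes D :: "(real^'n) set"
  assumes D: "tight_spherical_5_design D" and x: "x \<in> D"
  shows "- x \<in> D" and "y \<in> D \<Longrightarrow> y = x \<or> y = - x \<or> (x \<bullet> y)^2 = 1 / (real CARD('n) + 2)"
proof -
  define d where "d = real CARD('n)"
  have d: "d > 0" by (simp add: d_def)
  define q where "q = 1 / (d + 2)"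
  have fin: "finite D" and nD: "\<And>y. y \<in> D \<Longrightarrow> norm y = 1"
    using D by (auto simp: tight_spherical_5_design_def spherical_design_def)
  have xx: "x \<bullet> x = 1" using nD[OF x] by (simp add: norm_eq_1)
  have c: "(\<Sum>y\<in>D. 1::real) = d * (d + 1)"
    using D by (simp add: tight_spherical_5_design_def d_def algebra_simps)
  note sums = tight_design_sums(1,2)[OF D, where a = x, folded d_def, unfolded xx]
  have odds: "(\<Sum>y\<in>D. (x \<bullet> y)) = 0" "(\<Sum>y\<in>D. (x \<bullet> y)^3) = 0" "(\<Sum>y\<in>D. (x \<bullet> y)^5) = 0"
    using tight_design_sums(3)[OF D, of 1 x] tight_design_sums(3)[OF D, of 3 x]
      tight_design_sums(3)[OF D, of 5 x] by simp_all
  have "(\<Sum>y\<in>D. (x \<bullet> y) * ((x \<bullet> y)^2 - q)^2)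
      = (\<Sum>y\<in>D. (x \<bullet> y)^5 - 2 * q * (x \<bullet> y)^3 + q^2 * (x \<bullet> y))"
    by (intro sum.cong refl) algebra
  also have "\<dots> = 0"
    by (simp add: sum.distrib sum_subtractf sum_distrib_left[symmetric] odds)
  finally have sum1: "(\<Sum>y\<in>D. (x \<bullet> y) * ((x \<bullet> y)^2 - q)^2) = 0" .
  have "(\<Sum>y\<in>D. ((x \<bullet> y)^2 - q)^2) = (\<Sum>y\<in>D. (x \<bullet> y)^4 - 2 * q * (x \<bullet> y)^2 + q^2 * 1)"
    by (intro sum.cong refl) algebra
  also have "\<dots> = 3 * (d + 1) / (d + 2) - 2 * q * (d + 1) + q^2 * (d * (d + 1))"
    unfolding sum.distrib sum_subtractf sum_distrib_left[symmetric] sums c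
    by (simp add: sums)
  \<comment> \<open>The relation \<open>d * q = 1 - 2 * q\<close> eliminates
    \<open>d\<close>.\<close>
  also have "\<dots> = 2 * (1 - q)^2"
  proof -
    have "3 * (d + 1) / (d + 2) = 3 * (d + 1) * q" by (simp add: q_def)
    moreover have "d * q = 1 - 2 * q" using d by (simp add: q_def field_simps)
    ultimately show ?thesis by algebra
  qed
  finally have sum2: "(\<Sum>y\<in>D. ((x \<bullet> y)^2 - q)^2) = 2 * (1 - q)^2" .
  have q1: "1 - q > 0" using d by (simp add: q_def field_simps)
  let ?F = "\<lambda>y. (x \<bullet> y + 1) * ((x \<bullet> y)^2 - q)^2"
  have "sum ?F D = 2 * (1 - q)^2"
    using sum1 sum2 by (simp add: algebra_simps sum.distrib)
  moreover have "sum ?F D = ?F x + sum ?F (D - {x})"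
    using fin x by (rule sum.remove)
  ultimately have rest: "sum ?F (D - {x}) = 0" by (simp add: xx)
  have ge: "x \<bullet> y \<ge> - 1" if "y \<in> D" for y
    using Cauchy_Schwarz_ineq2[of x y] nD[OF that] nD[OF x] by simp
  then have "\<forall>y\<in>D - {x}. ?F y = 0"
    using sum_nonneg_eq_0_iff[of "D - {x}" ?F] rest fin by (smt (verit) Diff_iff finite_Diff mult_nonneg_nonneg zero_le_power2)
  then have zero: "x \<bullet> y + 1 = 0 \<or> (x \<bullet> y)^2 = q" if "y \<in> D" "y \<noteq> x" for y
    using that by auto
  have minus: "y = - x" if "y \<in> D" "x \<bullet> y = - 1" for y
  proof -
    have "(x + y) \<bullet> (x + y) = 0"
      using that nD[OF that(1)] xx by (simp add: inner_add_left inner_add_right inner_commute norm_eq_1)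
    then show ?thesis by (simp add: add_eq_0_iff)
  qed
  have cases: "y = - x \<or> (x \<bullet> y)^2 = q" if "y \<in> D" "y \<noteq> x" for y
    using zero[OF that] minus[OF that(1)] by (auto simp: add_eq_0_iff2)
  then show "y \<in> D \<Longrightarrow> y = x \<or> y = - x \<or> (x \<bullet> y)^2 = 1 / (real CARD('n) + 2)"
    by (auto simp: q_def d_def add.commute)
  show "- x \<in> D"
  \<comment> \<open>Without \<open>- x\<close>, every term of the odd sum except the one at
    \<open>x\<close> vanishes, so that sum would be \<open>(1 - q)^2 > 0\<close>, against
    \<open>sum1\<close>.\<close>
  proof (rule ccontr)
    assume "- x \<notin> D"
    then have "(x \<bullet> y)^2 = q" if "y \<in> D - {x}" for y using cases that by blast
    then have "(\<Sum>y\<in>D - {x}. (x \<bullet> y) * ((x \<bullet> y)^2 - q)^2) = 0" by simp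
    then have "(\<Sum>y\<in>D. (x \<bullet> y) * ((x \<bullet> y)^2 - q)^2) = (1 - q)^2"
      using sum.remove[OF fin x, of "\<lambda>y. (x \<bullet> y) * ((x \<bullet> y)^2 - q)^2"] by (simp add: xx)
    then show False using sum1 q1 by simp
  qed
qed

section \<open>Determinants of even symmetric matrices\<close>

text \<open>In the Leibniz expansion, a permutation moving an index outside \<open>S\<close> meets
  an off-diagonal zero in that row, so only permutations of \<open>S\<close> survive.\<close>

lemma det_identity_rows:
  fixes A :: "'a::comm_ring_1^'k^'k"
  assumes A: "\<And>k l. k \<notin> S \<Longrightarrow> A $ k $ l = (if k = l then 1 else 0)"
  shows "det A = (\<Sum>p | p permutes S. of_int (sign p) * (\<Prod>k\<in>S. A $ k $ p k))"
proof -
  have zero: "of_int (sign p) * (\<Prod>k\<in>UNIV. A $ k $ p k) = 0"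
    if p: "p permutes UNIV" "\<not> p permutes S" for p
  proof -
    obtain k where k: "k \<notin> S" "p k \<noteq> k" using p unfolding permutes_def by auto
    then have "A $ k $ p k = 0" using A by auto
    then have "(\<Prod>k\<in>UNIV. A $ k $ p k) = 0"
      by (subst prod.remove[of UNIV k]) auto
    then show ?thesis by simp
  qed
  have "det A = (\<Sum>p | p permutes S. of_int (sign p) * (\<Prod>k\<in>UNIV. A $ k $ p k))"
    unfolding det_def using zero
    by (intro sum.mono_neutral_right) (auto intro: permutes_subset)
  also have "\<dots> = (\<Sum>p | p permutes S. of_int (sign p) * (\<Prod>k\<in>S. A $ k $ p k))"
  proof (intro sum.cong refl)
    fix p assume "p \<in> {p. p permutes S}"
    then have "(\<Prod>k\<in>UNIV. A $ k $ p k) = (\<Prod>k\<in>S. A $ k $ p k)"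
      using A by (intro prod.mono_neutral_right) (auto dest: permutes_not_in)
    then show "of_int (sign p) * (\<Prod>k\<in>UNIV. A $ k $ p k) = of_int (sign p) * (\<Prod>k\<in>S. A $ k $ p k)"
      by simp
  qed
  finally show ?thesis .
qed

lemma det_identity_rows_doubleton:
  fixes A :: "'a::comm_ring_1^'k^'k"
  assumes "i \<noteq> j" and "\<And>k l. k \<notin> {i, j} \<Longrightarrow> A $ k $ l = (if k = l then 1 else 0)"
  shows "det A = A $ i $ i * A $ j $ j - A $ i $ j * A $ j $ i"
proof -
  have "{p. p permutes {i, j}} = {id, Transposition.transpose i j}"
    by (auto simp: permutes_doubleton_iff)
  moreover have "id \<noteq> Transposition.transpose i j"
    using assms(1) by (metis id_apply transpose_apply_first)
  moreover have "det A = (\<Sum>p | p permutes {i, j}. of_int (sign p) * (\<Prod>k\<in>{i, j}. A $ k $ p k))"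
    by (rule det_identity_rows[OF assms(2)])
  ultimately show ?thesis
    using assms(1) by (simp add: sign_swap_id)
qed

text \<open>The entries in rows of \<open>S\<close> and columns outside \<open>S\<close> never enter
  the expansion over permutations of \<open>S\<close>, so the matrix may be replaced by the diagonal
  matrix \<open>?B\<close>.\<close>

lemma det_identity_rows_scalar_block:
  fixes A :: "'a::comm_ring_1^'k^'k"
  assumes 1: "\<And>k l. k \<notin> S \<Longrightarrow> A $ k $ l = (if k = l then 1 else 0)"
    and 2: "\<And>k l. k \<in> S \<Longrightarrow> l \<in> S \<Longrightarrow> A $ k $ l = (if k = l then c else 0)"
  shows "det A = c ^ card S"
proof -
  let ?B = "(\<chi> k l. if k = l then (if k \<in> S then c else 1) else 0) :: 'a^'k^'k"
  have "det A = (\<Sum>p | p permutes S. of_int (sign p) * (\<Prod>k\<in>S. A $ k $ p k))"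
    by (rule det_identity_rows[OF 1])
  also have "\<dots> = (\<Sum>p | p permutes S. of_int (sign p) * (\<Prod>k\<in>S. ?B $ k $ p k))"
    using 2 by (intro sum.cong refl arg_cong2[where f = "(*)"] prod.cong)
      (auto simp: permutes_in_image)
  also have "\<dots> = det ?B"
    by (rule det_identity_rows[symmetric]) auto
  also have "\<dots> = (\<Prod>k\<in>UNIV. if k \<in> S then c else 1)"
    by (subst det_diagonal) auto
  also have "\<dots> = c ^ card S"
    by (subst prod.If_cases) auto
  finally show ?thesis .
qed

lemma dvd_det_row:
  fixes A :: "'a::comm_ring_1^'k^'k"
  assumes "\<And>l. q dvd A $ i $ l"
  shows "q dvd det A"
  unfolding det_def
  by (intro dvd_sum dvd_mult dvd_trans[OF assms dvd_prod_eqI]) auto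

text \<open>
  The size is carried by the index set \<open>I\<close>: outside \<open>I\<close> the matrix is the identity, so that one
  step of symmetric block elimination (a \<open>2 \<times> 2\<close> block with determinant \<open>p \<equiv> -1 (mod 4)\<close>) stays
  within one type.  Rows are multiplied by \<open>p\<close> instead of being divided by it; this changes the
  determinant by an even power of an odd number.
\<close>

lemma det_even_symmetric_induct:
  fixes A :: "int^'k^'k"
  assumes "\<And>k l. A $ k $ l = A $ l $ k"
    and "\<And>k. k \<in> I \<Longrightarrow> even (A $ k $ k)"
    and "\<And>k l. k \<notin> I \<Longrightarrow> A $ k $ l = (if k = l then 1 else 0)"
    and "odd (det A)"
  shows "even (card I) \<and> [det A = (- 1) ^ (card I div 2)] (mod 4)"
  using assms
proof (induction "card I" arbitrary: I A rule: less_induct)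
  case less
  note sym = less.prems(1) and ev = less.prems(2) and out = less.prems(3) and odd = less.prems(4)
  show ?case
  proof (cases "I = {}")
    case True
    then have "A = mat 1" using out by (simp add: vec_eq_iff mat_def)
    then show ?thesis using True by simp
  next
    case False
    then obtain i where i: "i \<in> I" by blast
    \<comment> \<open>A row of even entries would make the determinant even. The diagonal entry is
      even, so the pivot block uses a second index \<open>j\<close>.\<close>
    obtain j where j: "odd (A $ i $ j)"
      using odd dvd_det_row[of 2 A i] by blast
    have ij: "i \<noteq> j" using ev[OF i] j by auto
    have jI: "j \<in> I"
    proof (rule ccontr)
      assume "j \<notin> I"
      then have "A $ i $ j = 0" using out[of j i] sym[of i j] ij by simp
      then show False using j by simp
    qed
    define a b c where "a = A $ i $ i" and "b = A $ i $ j" and "c = A $ j $ j"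
    have ba: "A $ j $ i = b" using sym b_def by simp
    define p where "p = a * c - b * b"
    have "even a" "even c" "odd b" using ev i jI j by (auto simp: a_def b_def c_def)
    then have p: "[p = - 1] (mod 4)"
    proof -
      obtain a' b' c' where "a = 2 * a'" "b = 2 * b' + 1" "c = 2 * c'"
        using \<open>even a\<close> \<open>even c\<close> \<open>odd b\<close> by (metis evenE oddE)
      then have "p - (- 1) = 4 * (a' * c' - b' * b' - b')"
        by (simp add: p_def algebra_simps)
      then show ?thesis unfolding cong_iff_dvd_diff by simp
    qed
    define J where "J = I - {i, j}"
    have I: "I = insert i (insert j J)" and "i \<notin> J" "j \<notin> J" using i jI by (auto simp: J_def)
    then have cI: "card I = card J + 2" using ij by (subst I) simp
    \<comment> \<open>The row \<open>(A $ k $ i, A $ k $ j)\<close> times the adjugate of the pivot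
      block; \<open>p\<close> is the determinant of that block.\<close>
    define x y where "x k = A $ k $ i * c - A $ k $ j * b" and "y k = A $ k $ j * a - A $ k $ i * b" for k
    \<comment> \<open>On \<open>J\<close>, \<open>B\<close> is \<open>p\<close> times the Schur
      complement of the pivot block. The row operations \<open>E\<close> and the pivot rows
      \<open>M\<close> satisfy \<open>E ** A = B ** M\<close>, which relates the
      determinants.\<close>
    define B where "B = (\<chi> k l. if k \<in> J \<and> l \<in> J then p * A $ k $ l - x k * A $ i $ l - y k * A $ j $ l
        else if k = l then 1 else 0)"
    define E where "E = (\<chi> k l. if k \<in> J then (if l = k then p else if l = i then - x k else if l = j then - y k else 0)
        else if k = l then 1 else 0)"
    define M where "M = (\<chi> k l. if k \<in> {i, j} then A $ k $ l else if k = l then 1 else 0)"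
    have kill: "p * A $ k $ i - x k * a - y k * b = 0" "p * A $ k $ j - x k * b - y k * c = 0" for k
      by (simp_all add: p_def x_def y_def algebra_simps)
    have "(E ** A) $ k $ l = (B ** M) $ k $ l" for k l
    proof (cases "k \<in> J")
      case True
      then have k: "k \<noteq> i" "k \<noteq> j" by (auto simp: J_def)
      have "(E ** A) $ k $ l = (\<Sum>r\<in>{k, i, j}. E $ k $ r * A $ r $ l)"
        unfolding matrix_matrix_mult_def using True
        by (simp, intro sum.mono_neutral_right) (auto simp: E_def)
      also have "\<dots> = p * A $ k $ l - x k * A $ i $ l - y k * A $ j $ l"
        using k ij True by (simp add: E_def)
      finally have EA: "(E ** A) $ k $ l = p * A $ k $ l - x k * A $ i $ l - y k * A $ j $ l" .
      have "(B ** M) $ k $ l = (\<Sum>r\<in>J. B $ k $ r * M $ r $ l)"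
        unfolding matrix_matrix_mult_def using True
        by (simp, intro sum.mono_neutral_right) (auto simp: B_def)
      also have "\<dots> = (\<Sum>r\<in>J. if r = l then B $ k $ r else 0)"
        by (intro sum.cong) (auto simp: M_def J_def)
      also have "\<dots> = (if l \<in> J then B $ k $ l else 0)" by simp
      finally have BM: "(B ** M) $ k $ l = (if l \<in> J then B $ k $ l else 0)" .
      have "p * A $ k $ l - x k * A $ i $ l - y k * A $ j $ l = 0" if l: "l \<notin> J"
      proof -
        consider "l = i" | "l = j" | "l \<notin> I" using l by (auto simp: J_def)
        then show ?thesis
        proof cases
          case 1 then show ?thesis using kill(1)[of k] by (simp add: a_def ba)
        next
          case 2 then show ?thesis using kill(2)[of k] by (simp add: c_def b_def)
        next
          case 3
          then have "l \<noteq> k" "l \<noteq> i" "l \<noteq> j" using True i jI by (auto simp: J_def)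
          then show ?thesis using out[OF 3] sym[of _ l] by simp
        qed
      qed
      then show ?thesis using EA BM True by (auto simp: B_def)
    next
      case False
      have "(E ** A) $ k $ l = (\<Sum>r\<in>{k}. E $ k $ r * A $ r $ l)"
        unfolding matrix_matrix_mult_def using False
        by (simp, intro trans[OF sum.mono_neutral_right[of UNIV "{k}"]]) (auto simp: E_def)
      then have EA: "(E ** A) $ k $ l = A $ k $ l" using False by (simp add: E_def)
      have "(B ** M) $ k $ l = (\<Sum>r\<in>{k}. B $ k $ r * M $ r $ l)"
        unfolding matrix_matrix_mult_def using False
        by (simp, intro trans[OF sum.mono_neutral_right[of UNIV "{k}"]]) (auto simp: B_def)
      then have "(B ** M) $ k $ l = M $ k $ l" using False by (simp add: B_def)
      also have "\<dots> = A $ k $ l" using out[of k l] False by (auto simp: M_def J_def)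
      finally show ?thesis using EA by simp
    qed
    then have "E ** A = B ** M" by (simp add: vec_eq_iff)
    then have "det E * det A = det B * det M" by (simp only: det_mul[symmetric])
    moreover have "det E = p ^ card J"
      by (rule det_identity_rows_scalar_block) (auto simp: E_def J_def)
    moreover have "det M = p"
      using ij by (subst det_identity_rows_doubleton[of i j]) (auto simp: M_def p_def a_def b_def c_def ba)
    ultimately have eq: "p ^ card J * det A = det B * p" by simp
    have "odd p"
      using cong_dvd_modulus[OF p, of 2] by (auto simp: cong_iff_dvd_diff)
    then have oB: "odd (det B)" using arg_cong[OF eq, of even] odd by simp
    have symB: "B $ k $ l = B $ l $ k" for k l
      using sym[of k l] sym[of i k] sym[of j k] sym[of i l] sym[of j l]
      by (auto simp: B_def x_def y_def algebra_simps)
    have evB: "even (B $ k $ k)" if "k \<in> J" for k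
    proof -
      \<comment> \<open>A binary quadratic form with even diagonal coefficients \<open>c\<close> and
        \<open>a\<close> and an even cross term takes even values, so \<open>B\<close> again has
        even diagonal.\<close>
      have "x k * A $ i $ k + y k * A $ j $ k
          = c * (A $ k $ i)^2 + a * (A $ k $ j)^2 - 2 * (b * A $ k $ i * A $ k $ j)"
        using sym[of i k] sym[of j k] by (simp add: x_def y_def power2_eq_square algebra_simps)
      moreover have "even (A $ k $ k)" using that ev by (auto simp: J_def)
      ultimately have "even (p * A $ k $ k - (x k * A $ i $ k + y k * A $ j $ k))"
        using \<open>even a\<close> \<open>even c\<close> by simp
      then show ?thesis using that by (simp add: B_def diff_diff_eq)
    qed
    have "even (card J) \<and> [det B = (- 1) ^ (card J div 2)] (mod 4)"
      by (rule less.hyps) (use cI symB evB oB in \<open>auto simp: B_def\<close>)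
    then have eJ: "even (card J)" and dB: "[det B = (- 1) ^ (card J div 2)] (mod 4)" by auto
    \<comment> \<open>As \<open>card J\<close> is even, this power is 1 modulo 4; the single factor
      \<open>p\<close> on the other side supplies the sign change for two more indices.\<close>
    have "[p ^ card J = (- 1) ^ card J] (mod 4)" by (rule cong_pow[OF p])
    from cong_scalar_right[OF this, of "det A"] have "[p ^ card J * det A = det A] (mod 4)"
      using eJ by simp
    moreover have "[det B * p = (- 1) ^ (card J div 2) * (- 1)] (mod 4)"
      by (rule cong_mult[OF dB p])
    ultimately have "[det A = (- 1) ^ (card J div 2) * (- 1)] (mod 4)"
      unfolding eq by (rule cong_trans[OF cong_sym])
    then show ?thesis using eJ cI by simp
  qed
qed

lemma det_even_symmetric:
  fixes A :: "int^'k^'k"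
  assumes "\<And>k l. A $ k $ l = A $ l $ k" and "\<And>k. even (A $ k $ k)" and "odd (det A)"
    and "4 dvd CARD('k)"
  shows "[det A = 1] (mod 4)"
proof -
  have "[det A = (- 1) ^ (CARD('k) div 2)] (mod 4)"
    using det_even_symmetric_induct[of A UNIV] assms by auto
  moreover have "even (CARD('k) div 2)" using assms(4) by (auto elim!: dvdE)
  ultimately show ?thesis by simp
qed

section \<open>Integral lattices\<close>

lemma det_of_int:
  "det (\<chi> i j. of_int (A $ i $ j)) = of_int (det (A :: int^'k^'k))"
  by (simp add: det_def)

lemma det_in_Ints:
  fixes A :: "real^'k^'k"
  assumes "\<And>i j. A $ i $ j \<in> \<int>"
  shows "det A \<in> \<int>"
  unfolding det_def using assms by (intro Ints_sum Ints_mult Ints_prod) auto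

definition dual_lattice :: "'a::real_inner set \<Rightarrow> 'a set" where
  "dual_lattice K = {u. \<forall>v\<in>K. u \<bullet> v \<in> \<int>}"

text \<open>Full rank is stated as nondegeneracy, the form that the second moment of the design
  delivers. Discreteness is not assumed: integrality of the inner products replaces it in
  \<open>exists_basis\<close>.\<close>

locale integral_lattice =
  fixes K :: "(real^'k) set"
  assumes zero: "0 \<in> K"
    and add: "\<And>u v. u \<in> K \<Longrightarrow> v \<in> K \<Longrightarrow> u + v \<in> K"
    and uminus: "\<And>u. u \<in> K \<Longrightarrow> - u \<in> K"
    and full: "\<And>u. (\<And>v. v \<in> K \<Longrightarrow> u \<bullet> v = 0) \<Longrightarrow> u = 0"
    and integral: "\<And>u v. u \<in> K \<Longrightarrow> v \<in> K \<Longrightarrow> u \<bullet> v \<in> \<int>"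
begin

lemma int_scale:
  assumes "u \<in> K" shows "of_int c *\<^sub>R u \<in> K"
proof -
  have nat: "of_nat n *\<^sub>R u \<in> K" for n
    by (induction n) (auto simp: zero add assms algebra_simps)
  show ?thesis
    using nat[of "nat c"] uminus[OF nat[of "nat (- c)"]] by (cases "c \<ge> 0") auto
qed

lemma sum_closed:
  assumes "\<And>i. i \<in> A \<Longrightarrow> f i \<in> K"
  shows "sum f A \<in> K"
  using assms by (induction A rule: infinite_finite_induct) (auto simp: zero add)

lemma Ints_combination:
  assumes "\<And>i. i \<in> A \<Longrightarrow> c i \<in> \<int>" "\<And>i. i \<in> A \<Longrightarrow> b i \<in> K"
  shows "(\<Sum>i\<in>A. c i *\<^sub>R b i) \<in> K"
  using assms by (intro sum_closed) (metis Ints_cases int_scale)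

lemma span_eq: "span K = UNIV"
proof (rule ccontr)
  assume "span K \<noteq> UNIV"
  then obtain a where a: "a \<noteq> 0" "\<forall>x\<in>span K. a \<bullet> x = 0"
    using span_not_UNIV_orthogonal by blast
  then have "a = 0" by (intro full) (auto intro: span_base)
  then show False using a by simp
qed

lemma exists_frame: "\<exists>b::real^'k^'k. (\<forall>i. b $ i \<in> K) \<and> det b \<noteq> 0"
proof -
  obtain B where B: "B \<subseteq> K" "independent B" "K \<subseteq> span B" "card B = dim K"
    using basis_exists by blast
  have sB: "span B = UNIV"
    using span_mono[OF B(3)] by (auto simp: span_eq span_span)
  have "dim K = CARD('k)"
    using dim_span[of K] by (simp add: span_eq)
  then obtain h where h: "bij_betw h (UNIV :: 'k set) B"
    by (metis finite_same_card_bij B(2,4) finiteI_independent finite)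
  let ?b = "(\<chi> i. h i) :: real^'k^'k"
  have "rows ?b = B" using h by (auto simp: rows_def row_def bij_betw_def)
  then obtain C where "C ** ?b = mat 1"
    using matrix_left_invertible_span_rows[of ?b] sB by auto
  from arg_cong[OF this, of det] have "det ?b \<noteq> 0" by (auto simp: det_mul)
  moreover have "?b $ i \<in> K" for i using h B(1) by (auto simp: bij_betw_def)
  ultimately show ?thesis by blast
qed

text \<open>The product is the determinant of the matrix of inner products. It is applied both
  within \<open>K\<close> and to \<open>K\<close> against its dual.\<close>

lemma gram_det_Ints:
  fixes b c :: "real^'k^'k"
  assumes "\<And>i j. b $ i \<bullet> c $ j \<in> \<int>"
  shows "det b * det c \<in> \<int>"
proof -
  have "(b ** transpose c) $ i $ j = b $ i \<bullet> c $ j" for i j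
    by (simp add: matrix_matrix_mult_def transpose_def inner_vec_def)
  then have "det (b ** transpose c) \<in> \<int>" using assms by (intro det_in_Ints) simp
  then show ?thesis by (simp add: det_mul)
qed

text \<open>
  A system of lattice vectors with minimal non-zero determinant is a \<open>\<int>\<close>-basis: reducing
  a coordinate modulo \<open>1\<close> multiplies the determinant by the fractional part.
\<close>

lemma exists_basis:
  obtains b :: "real^'k^'k" where "\<And>i. b $ i \<in> K" "det b \<noteq> 0"
    and "\<And>x i. (\<Sum>j\<in>UNIV. x j *\<^sub>R b $ j) \<in> K \<Longrightarrow> x i \<in> \<int>"
proof -
  let ?P = "\<lambda>b::real^'k^'k. (\<forall>i. b $ i \<in> K) \<and> det b \<noteq> 0"
  \<comment> \<open>The squared determinant of a system in \<open>K\<close> is an integer, so a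
    minimum exists.\<close>
  let ?f = "\<lambda>b::real^'k^'k. nat \<lfloor>(det b)\<^sup>2\<rfloor>"
  have f: "real (?f b) = (det b)\<^sup>2" if "?P b" for b
  proof -
    have "det b * det b \<in> \<int>" using that by (intro gram_det_Ints integral) auto
    then have "of_int \<lfloor>(det b)\<^sup>2\<rfloor> = (det b)\<^sup>2" by (simp add: power2_eq_square)
    then show ?thesis by simp
  qed
  obtain b where b: "?P b" and min: "\<And>c. ?P c \<Longrightarrow> ?f b \<le> ?f c"
    using ex_has_least_nat[of ?P _ ?f] exists_frame by blast
  have "x k \<in> \<int>" if v: "(\<Sum>j\<in>UNIV. x j *\<^sub>R b $ j) \<in> K" for x k
  proof (rule ccontr)
    assume k: "x k \<notin> \<int>"
    define y :: "real^'k" where "y = (\<chi> j. if j = k then frac (x k) else x j)"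
    let ?c = "(\<chi> i. if i = k then \<Sum>i\<in>UNIV. y $ i *s row i b else row i b) :: real^'k^'k"
    have dc: "det ?c = frac (x k) * det b"
      unfolding cramer_lemma_transpose by (simp add: y_def)
    have "(\<Sum>i\<in>UNIV. y $ i *s row i b)
        = (\<Sum>j\<in>UNIV. x j *\<^sub>R b $ j - (if j = k then of_int \<lfloor>x k\<rfloor> *\<^sub>R b $ k else 0))"
      by (intro sum.cong refl) (auto simp: y_def row_def vec_eq_iff frac_def algebra_simps)
    also have "\<dots> = (\<Sum>j\<in>UNIV. x j *\<^sub>R b $ j) + - (of_int \<lfloor>x k\<rfloor> *\<^sub>R b $ k)"
      by (simp add: sum_subtractf)
    also have "\<dots> \<in> K" using v b by (intro add uminus int_scale) auto
    finally have "?c $ i \<in> K" for i using b by (simp add: row_def)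
    moreover have "det ?c \<noteq> 0" using dc b k by (simp add: frac_eq_0_iff)
    ultimately have c: "?P ?c" by blast
    have "(det b)\<^sup>2 \<le> (det ?c)\<^sup>2"
      using min[OF c] f[OF b] f[OF c] by linarith
    also have "\<dots> = (frac (x k))\<^sup>2 * (det b)\<^sup>2"
      unfolding dc by (simp add: power_mult_distrib)
    also have "\<dots> < 1 * (det b)\<^sup>2"
      using frac_lt_1[of "x k"] frac_ge_0[of "x k"] b
      by (intro mult_strict_right_mono) (auto simp: power_less_one_iff)
    finally show False by simp
  qed
  then show ?thesis using b that by blast
qed

text \<open>The form \<open>3 * (u \<bullet> u) / 2\<close> on the dual takes only the residues 0
  and \<open>t\<close> modulo 3. This bounds the discriminant group by order 3, so the Gram
  determinant is 1 or 3; evenness and rank divisible by 4 make it 1 modulo 4, hence 1.\<close>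

lemma dual_subset_of_three_modular:
  assumes four: "4 dvd CARD('k)"
    and even: "\<And>v. v \<in> K \<Longrightarrow> \<exists>z::int. v \<bullet> v = 2 * z"
    and t: "\<not> 3 dvd (t::int)"
    and Q: "\<And>u. u \<in> dual_lattice K \<Longrightarrow> \<exists>z::int. 3 * (u \<bullet> u) / 2 = real_of_int z \<and> ((3::int) dvd z \<or> (3::int) dvd z - t)"
  shows "dual_lattice K \<subseteq> K"
proof (rule ccontr)
  let ?L = "dual_lattice K"
  assume not: "\<not> ?L \<subseteq> K"
  obtain b :: "real^'k^'k" where bK: "\<And>i. b $ i \<in> K" and b0: "det b \<noteq> 0"
    and coord: "\<And>x i. (\<Sum>j\<in>UNIV. x j *\<^sub>R b $ j) \<in> K \<Longrightarrow> x i \<in> \<int>"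
    by (rule exists_basis, rule that)
  obtain C where C: "b ** C = mat 1" "C ** b = mat 1"
    using b0 unfolding invertible_det_nz[symmetric] invertible_def by blast
  define b' where "b' = transpose C"
  have dets: "det b * det b' = 1"
    using arg_cong[OF C(1), of det] by (simp add: det_mul b'_def)
  have expand: "w = (\<Sum>i\<in>UNIV. (w \<bullet> b' $ i) *\<^sub>R b $ i)" for w
  proof -
    have "w = w v* (C ** b)" by (simp add: C)
    also have "\<dots> = (w v* C) v* b" by (simp add: vector_matrix_mul_assoc)
    also have "\<dots> = (\<Sum>i\<in>UNIV. (w \<bullet> b' $ i) *\<^sub>R b $ i)"
      by (simp add: vec_eq_iff vector_matrix_mult_def b'_def transpose_def inner_vec_def mult_ac)
    finally show ?thesis .
  qed
  have expand': "w = (\<Sum>i\<in>UNIV. (w \<bullet> b $ i) *\<^sub>R b' $ i)" for w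
  proof -
    have "w = C *v (b *v w)" by (simp add: matrix_vector_mul_assoc C)
    also have "\<dots> = (\<Sum>i\<in>UNIV. (w \<bullet> b $ i) *\<^sub>R b' $ i)"
      by (simp add: vec_eq_iff matrix_vector_mult_def b'_def transpose_def inner_vec_def mult_ac)
    finally show ?thesis .
  qed
  have b'L: "b' $ i \<in> ?L" for i
    unfolding dual_lattice_def
  proof (intro CollectI ballI)
    fix v assume "v \<in> K"
    then have "v \<bullet> b' $ i \<in> \<int>" using coord[of "\<lambda>i. v \<bullet> b' $ i" i] expand[of v] by simp
    then show "b' $ i \<bullet> v \<in> \<int>" by (simp add: inner_commute)
  qed
  have dual: "w \<bullet> u \<in> \<int>" if "w \<in> K" "u \<in> ?L" for w u
    using that by (auto simp: dual_lattice_def inner_commute[of w])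
  \<comment> \<open>The coordinates of \<open>w\<close> in the basis \<open>b\<close> are its
    products with the dual basis \<open>b'\<close>, so the dual of the dual lies in
    \<open>K\<close>.\<close>
  have in_K: "w \<in> K" if "\<And>v. v \<in> ?L \<Longrightarrow> w \<bullet> v \<in> \<int>" for w
    by (subst expand) (intro Ints_combination bK that b'L)
  have L_add: "u + v \<in> ?L" "u - v \<in> ?L" if "u \<in> ?L" "v \<in> ?L" for u v
    using that by (auto simp: dual_lattice_def inner_add_left inner_diff_left)
  define q where "q u = \<lfloor>3 * (u \<bullet> u) / 2\<rfloor>" for u :: "real^'k"
  have q: "3 * (u \<bullet> u) / 2 = of_int (q u)" "3 dvd q u \<or> 3 dvd q u - t" if "u \<in> ?L" for u
    using Q[OF that] by (auto simp: q_def)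
  define \<beta> where "\<beta> u v = q (u + v) - q u - q v" for u v
  have polar: "3 * (u \<bullet> v) = of_int (\<beta> u v)" "q (u - v) = q u + q v - \<beta> u v"
    if uv: "u \<in> ?L" "v \<in> ?L" for u v
  proof -
    note qs = q(1)[OF uv(1)] q(1)[OF uv(2)] q(1)[OF L_add(1)[OF uv]] q(1)[OF L_add(2)[OF uv]]
    show 1: "3 * (u \<bullet> v) = of_int (\<beta> u v)"
      using qs by (simp add: \<beta>_def inner_add_left inner_add_right inner_commute[of v u] field_simps)
    have "real_of_int (q (u - v)) = of_int (q u + q v - \<beta> u v)"
      using qs(1,2,4) 1 by (simp add: inner_diff_left inner_diff_right inner_commute[of v u] field_simps)
    then show "q (u - v) = q u + q v - \<beta> u v" by (simp only: of_int_eq_iff)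
  qed
  have q_sum: "q (u + v) = q u + q v + \<beta> u v" for u v by (simp add: \<beta>_def)
  \<comment> \<open>If 3 did not divide \<open>\<beta> u v\<close>, then \<open>q v\<close>,
    \<open>q (u + v)\<close> and \<open>q (u - v)\<close> would be three distinct residues modulo 3,
    but only two are allowed. So \<open>u \<bullet> v\<close> is integral for every dual
    \<open>v\<close>.\<close>
  have isotropic: "u \<in> K" if u: "u \<in> ?L" "3 dvd q u" for u
  proof (rule in_K)
    fix v assume v: "v \<in> ?L"
    have "3 dvd \<beta> u v"
      using u(2) q(2)[OF v] q(2)[OF L_add(1)[OF u(1) v]] q(2)[OF L_add(2)[OF u(1) v]]
      unfolding polar(2)[OF u(1) v] q_sum by presburger
    then obtain z where "\<beta> u v = 3 * z" by blast
    then have "u \<bullet> v = of_int z" using polar(1)[OF u(1) v] by simp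
    then show "u \<bullet> v \<in> \<int>" by simp
  qed
  \<comment> \<open>If all four values were \<open>t\<close> modulo 3, the parallelogram law would
    give \<open>2 * t = 4 * t\<close> modulo 3, impossible since 3 does not divide
    \<open>t\<close>.\<close>
  have cyclic: "u \<in> K \<or> v \<in> K \<or> u - v \<in> K \<or> u + v \<in> K" if uv: "u \<in> ?L" "v \<in> ?L" for u v
  proof -
    have "3 dvd q u \<or> 3 dvd q v \<or> 3 dvd q (u - v) \<or> 3 dvd q (u + v)"
      using t q(2)[OF uv(1)] q(2)[OF uv(2)] q(2)[OF L_add(1)[OF uv]] q(2)[OF L_add(2)[OF uv]]
      unfolding polar(2)[OF uv] q_sum by presburger
    then show ?thesis using isotropic uv L_add[OF uv] by blast
  qed
  have three: "3 *\<^sub>R u \<in> K" if u: "u \<in> ?L" for u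
    by (rule in_K) (use polar(1)[OF u] in simp)
  \<comment> \<open>This vector generates the dual modulo \<open>K\<close>.\<close>
  obtain i where i: "b' $ i \<notin> K"
  proof (rule ccontr)
    assume "\<not> thesis"
    then have b'K: "b' $ i \<in> K" for i using that by blast
    have "w \<in> K" if "w \<in> ?L" for w
      by (subst expand') (intro Ints_combination b'K, use that bK in \<open>auto simp: dual_lattice_def\<close>)
    then show False using not by blast
  qed
  have "\<exists>c. b' $ j - c *\<^sub>R b' $ i \<in> K" for j
  proof -
    have "b' $ j - 0 *\<^sub>R b' $ i \<in> K \<or> b' $ j - 1 *\<^sub>R b' $ i \<in> K \<or> b' $ j - (- 1) *\<^sub>R b' $ i \<in> K"
      using cyclic[OF b'L[of j] b'L[of i]] i by simp
    then show ?thesis by blast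
  qed
  then obtain c where c: "\<And>j. b' $ j - c j *\<^sub>R b' $ i \<in> K" by metis
  \<comment> \<open>The transpose of \<open>E\<close> turns the dual basis into
    \<open>3 *\<^sub>R b' $ i\<close> and the differences
    \<open>b' $ j - c j *\<^sub>R b' $ i\<close>, all in \<open>K\<close>.\<close>
  define E :: "real^'k^'k" where "E = (\<chi> l j. if l = i then (if j = i then 3 else - c j) else if l = j then 1 else 0)"
  have detE: "det E = 3"
    using det_identity_rows_scalar_block[of "{i}" E 3] by (simp add: E_def)
  have "(transpose E ** b') $ j = (if j = i then 3 *\<^sub>R b' $ i else b' $ j - c j *\<^sub>R b' $ i)" for j
  proof -
    have "(transpose E ** b') $ j = (\<Sum>l\<in>UNIV. E $ l $ j *\<^sub>R b' $ l)"
      by (simp add: vec_eq_iff matrix_matrix_mult_def transpose_def)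
    also have "\<dots> = (\<Sum>l\<in>{i, j}. E $ l $ j *\<^sub>R b' $ l)"
      by (rule sum.mono_neutral_right) (auto simp: E_def)
    finally show ?thesis by (simp add: E_def)
  qed
  then have "(transpose E ** b') $ j \<in> K" for j
    using c three b'L by simp
  \<comment> \<open>Vectors of \<open>K\<close> are paired with dual vectors. Since
    \<open>det b * det b' = 1\<close>, the result says that \<open>det G\<close> divides 3.\<close>
  then have "det (transpose E ** b') * det b' \<in> \<int>"
    by (intro gram_det_Ints dual b'L)
  then have "3 * (det b' * det b') \<in> \<int>" by (simp add: det_mul detE mult.assoc)
  then obtain z where z: "3 * (det b' * det b') = of_int z" by (auto elim: Ints_cases)
  define G :: "int^'k^'k" where "G = (\<chi> i j. \<lfloor>b $ i \<bullet> b $ j\<rfloor>)"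
  have G: "real_of_int (G $ i $ j) = b $ i \<bullet> b $ j" for i j
    using integral[OF bK bK, of i j] by (simp add: G_def)
  have "b ** transpose b = (\<chi> i j. of_int (G $ i $ j))"
    by (simp add: G vec_eq_iff matrix_matrix_mult_def transpose_def inner_vec_def)
  then have detG: "of_int (det G) = det b * det b"
    by (metis det_mul det_of_int det_transpose)
  have "real_of_int (det G * z) = 3 * (det b * det b') * (det b * det b')"
    unfolding of_int_mult detG z[symmetric] by (simp add: mult_ac)
  then have "real_of_int (det G * z) = of_int 3" by (simp add: dets)
  then have "det G * z = 3" by (simp only: of_int_eq_iff)
  moreover have "det G > 0"
  proof -
    have "real_of_int (det G) > 0" unfolding detG using b0 by (metis not_real_square_gt_zero)
    then show ?thesis by simp
  qed
  ultimately have G13: "det G = 1 \<or> det G = 3"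
  proof -
    assume *: "det G * z = 3" "det G > 0"
    then have "det G dvd 3" by (metis dvd_triv_left)
    then have "det G \<le> 3" by (rule zdvd_imp_le) simp
    then consider "det G = 1" | "det G = 2" | "det G = 3" using *(2) by linarith
    then show ?thesis
    proof cases
      case 2
      then have "2 * z = 3" using *(1) by simp
      then show ?thesis by presburger
    qed auto
  qed
  moreover have "[det G = 1] (mod 4)"
  proof (rule det_even_symmetric[OF _ _ _ four])
    show "G $ k $ l = G $ l $ k" for k l by (simp add: G_def inner_commute)
    show "even (G $ k $ k)" for k
    proof -
      obtain z where "b $ k \<bullet> b $ k = 2 * real_of_int z" using even[OF bK, of k] by blast
      then have "real_of_int (G $ k $ k) = of_int (2 * z)" by (simp add: G)
      then show ?thesis by (simp only: of_int_eq_iff) simp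
    qed
    show "odd (det G)" using G13 by auto
  qed
  ultimately have "det G = 1" by (auto simp: cong_def)
  then have unimodular: "det b * det b = 1" using detG by simp
  \<comment> \<open>By Cramer's rule a coordinate of \<open>u\<close> is
    \<open>det ?R / det b\<close>, which equals \<open>det ?R * det b\<close> here, a determinant of
    integral inner products.\<close>
  have "u \<in> K" if u: "u \<in> ?L" for u
  proof (subst expand, intro Ints_combination bK)
    fix k
    let ?x = "(\<chi> i. u \<bullet> b' $ i) :: real^'k"
    let ?R = "(\<chi> i. if i = k then \<Sum>i\<in>UNIV. ?x $ i *s row i b else row i b) :: real^'k^'k"
    have "(\<Sum>i\<in>UNIV. ?x $ i *s row i b) = u"
      by (subst (2) expand) (simp add: row_def scalar_mult_eq_scaleR)
    then have R: "?R $ i = (if i = k then u else b $ i)" for i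
      by (simp add: row_def)
    have "det ?R * det b \<in> \<int>"
      by (rule gram_det_Ints) (use R u bK integral in \<open>auto simp: dual_lattice_def\<close>)
    then show "u \<bullet> b' $ k \<in> \<int>"
      unfolding cramer_lemma_transpose by (simp add: mult.assoc unimodular)
  qed
  then show False using not by blast
qed

end

section \<open>The lattice of a tight design\<close>

inductive_set int_span :: "'a::ab_group_add set \<Rightarrow> 'a set" for Z where
  zero: "0 \<in> int_span Z"
| add: "v \<in> int_span Z \<Longrightarrow> x \<in> Z \<Longrightarrow> v + x \<in> int_span Z"
| diff: "v \<in> int_span Z \<Longrightarrow> x \<in> Z \<Longrightarrow> v - x \<in> int_span Z"

lemma int_span_base: "x \<in> Z \<Longrightarrow> x \<in> int_span Z"
  using int_span.add[OF int_span.zero] by force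

lemma int_span_add:
  assumes "u \<in> int_span Z" "v \<in> int_span Z"
  shows "u + v \<in> int_span Z"
  using assms(2)
proof induction
  case zero
  then show ?case using assms(1) by simp
next
  case (add v x)
  then show ?case using int_span.add[of "u + v" Z x] by (simp add: add.assoc)
next
  case (diff v x)
  then show ?case using int_span.diff[of "u + v" Z x] by (simp add: add_diff_eq)
qed

lemma int_span_uminus: "u \<in> int_span Z \<Longrightarrow> - u \<in> int_span Z"
proof (induction rule: int_span.induct)
  case zero
  then show ?case by (simp add: int_span.zero)
next
  case (add v x)
  then show ?case using int_span.diff[of "- v" Z x] by simp
next
  case (diff v x)
  then show ?case using int_span.add[of "- v" Z x] by simp
qed

lemma int_span_inner_Ints:
  fixes u :: "'a::real_inner"
  assumes "v \<in> int_span Z" "\<And>x. x \<in> Z \<Longrightarrow> u \<bullet> x \<in> \<int>"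
  shows "u \<bullet> v \<in> \<int>"
  using assms by induction (auto simp: inner_add_right inner_diff_right)

lemma dual_lattice_int_span:
  fixes Z :: "'a::real_inner set"
  shows "dual_lattice (int_span Z) = {u. \<forall>x\<in>Z. u \<bullet> x \<in> \<int>}"
  by (auto simp: dual_lattice_def int_span_base intro: int_span_inner_Ints)

text \<open>Adding or subtracting a generator changes the norm by its own even norm and by twice an
  integer.\<close>

lemma int_span_even:
  fixes v :: "'a::real_inner"
  assumes "v \<in> int_span Z" and int: "\<And>x y. x \<in> Z \<Longrightarrow> y \<in> Z \<Longrightarrow> x \<bullet> y \<in> \<int>"
    and even: "\<And>x. x \<in> Z \<Longrightarrow> \<exists>z::int. x \<bullet> x = 2 * real_of_int z"
  shows "\<exists>z::int. v \<bullet> v = 2 * real_of_int z"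
  using assms(1)
proof induction
  case zero
  show ?case by (intro exI[of _ 0]) simp
next
  case (add v x)
  then obtain z z' where z: "v \<bullet> v = 2 * real_of_int z" "x \<bullet> x = 2 * real_of_int z'"
    using even by blast
  have "x \<bullet> v \<in> \<int>" using add int by (intro int_span_inner_Ints[of v Z]) auto
  then obtain k where "x \<bullet> v = of_int k" by (auto elim: Ints_cases)
  then have "(v + x) \<bullet> (v + x) = 2 * real_of_int (z + z' + k)"
    using z by (simp add: inner_add_left inner_add_right inner_commute[of v x])
  then show ?case by blast
next
  case (diff v x)
  then obtain z z' where z: "v \<bullet> v = 2 * real_of_int z" "x \<bullet> x = 2 * real_of_int z'"
    using even by blast
  have "x \<bullet> v \<in> \<int>" using diff int by (intro int_span_inner_Ints[of v Z]) auto
  then obtain k where "x \<bullet> v = of_int k" by (auto elim: Ints_cases)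
  then have "(v - x) \<bullet> (v - x) = 2 * real_of_int (z + z' - k)"
    using z by (simp add: inner_diff_left inner_diff_right inner_commute[of v x])
  then show ?case by blast
qed

lemma integral_lattice_int_span:
  fixes Z :: "(real^'k) set"
  assumes "\<And>u. (\<And>x. x \<in> Z \<Longrightarrow> u \<bullet> x = 0) \<Longrightarrow> u = 0"
    and int: "\<And>x y. x \<in> Z \<Longrightarrow> y \<in> Z \<Longrightarrow> x \<bullet> y \<in> \<int>"
  shows "integral_lattice (int_span Z)"
proof
  show "u = 0" if "\<And>v. v \<in> int_span Z \<Longrightarrow> u \<bullet> v = 0" for u
    using assms(1) that int_span_base by blast
  show "u \<bullet> v \<in> \<int>" if "u \<in> int_span Z" "v \<in> int_span Z" for u v
  proof (rule int_span_inner_Ints[OF that(2)])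
    fix x assume "x \<in> Z"
    then have "x \<bullet> u \<in> \<int>" using that(1) int by (intro int_span_inner_Ints[of u Z]) auto
    then show "u \<bullet> x \<in> \<int>" by (simp add: inner_commute)
  qed
qed (auto intro: int_span.zero int_span_add int_span_uminus)

section \<open>Adjoining one orthogonal coordinate\<close>

definition append_coord :: "real^'n \<Rightarrow> real \<Rightarrow> real^('n option)" where
  "append_coord p q = (\<chi> i. case i of None \<Rightarrow> q | Some j \<Rightarrow> p $ j)"

lemma append_coord_inner: "append_coord p q \<bullet> append_coord p' q' = p \<bullet> p' + q * q'"
  by (simp add: append_coord_def inner_vec_def UNIV_option_conv sum.reindex)

lemma append_coord_diff: "append_coord p q - append_coord p' q' = append_coord (p - p') (q - q')"
  by (auto simp: append_coord_def vec_eq_iff split: option.split)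

lemma append_coord_cases: obtains p q where "u = append_coord p q"
proof
  show "u = append_coord (\<chi> j. u $ Some j) (u $ None)"
    by (auto simp: append_coord_def vec_eq_iff split: option.split)
qed

lemma append_coord_eq_0_iff: "append_coord p q = 0 \<longleftrightarrow> p = 0 \<and> q = 0"
  by (auto simp: append_coord_def vec_eq_iff split: option.split_asm option.split)

text \<open>In \<open>t^2 * (t - 1) * (t + 1)\<close> one of three consecutive integers is a
  multiple of 3, and either \<open>t\<close> or both of its neighbours are even.\<close>

lemma twelve_dvd_power4_minus_square: "12 dvd t^4 - t^2" for t :: int
proof -
  have eq: "t^4 - t^2 = t * (t * ((t - 1) * (t + 1)))" by algebra
  have "3 dvd t \<or> 3 dvd t - 1 \<or> 3 dvd t + 1" by presburger
  then have 3: "3 dvd t^4 - t^2" unfolding eq by (auto intro: dvd_mult dvd_mult2)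
  have "2 * 2 dvd t * t \<or> 2 * 2 dvd (t - 1) * (t + 1)"
    using mult_dvd_mono[of 2 t 2 t] mult_dvd_mono[of 2 "t - 1" 2 "t + 1"] by presburger
  then have "2 * 2 dvd (t * t) * ((t - 1) * (t + 1))" by (auto intro: dvd_mult dvd_mult2)
  then have 4: "4 dvd t^4 - t^2" unfolding eq by (simp add: mult.assoc)
  show ?thesis using 3 4 by presburger
qed

text \<open>With \<open>w = p / q\<close> in lowest terms, \<open>q^2\<close> is coprime to
  \<open>p * (p - s * q)\<close> and so divides \<open>h\<close>, which excludes odd primes in
  \<open>q\<close>. Once \<open>w\<close> is an integer, 3 divides \<open>h\<close> exactly once
  while the right side has a factor 9, which leaves a factor 3 for
  \<open>w * (w - s)\<close>.\<close>

lemma integrality_of_scaled_norm: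
  fixes h s :: nat and w :: real and k :: int
  assumes w: "w \<in> \<rat>" and eq: "h * w * (w - s) = 18 * real_of_int k"
    and not_8_dvd: "\<not> 8 dvd h" and h3: "3 dvd h"
    and sqf: "\<And>p::nat. prime p \<Longrightarrow> odd p \<Longrightarrow> \<not> p^2 dvd h"
  shows "\<exists>z::int. w = z \<and> ((3::int) dvd z \<or> (3::int) dvd z - int s)"
proof -
  obtain p q :: int where q: "q > 0" and cop: "coprime p q" and wpq: "w = of_int p / of_int q"
    using w by (rule Rats_cases')
  have "real h * (p * (p - s * q)) = 18 * k * (real_of_int q)^2"
    using eq q by (simp add: wpq field_simps power2_eq_square)
  then have "real_of_int (int h * (p * (p - int s * q))) = real_of_int (18 * k * q^2)" by simp
  then have E: "int h * (p * (p - int s * q)) = 18 * k * q^2" by (simp only: of_int_eq_iff)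
  have cop2: "coprime (p - int s * q) q"
    using cop by (metis coprime_commute diff_conv_add_uminus gcd_add_mult coprime_iff_gcd_eq_1 mult_minus_left add.commute)
  have "coprime (q^2) (p * (p - int s * q))"
    using cop cop2 by (simp add: coprime_commute)
  moreover have "q^2 dvd int h * (p * (p - int s * q))" by (simp add: E)
  ultimately have qh: "q^2 dvd int h" by (simp add: coprime_dvd_mult_left_iff)
  have "q = 1"
  proof (rule ccontr)
    assume "q \<noteq> 1"
    then have "nat q \<noteq> 1" using q by linarith
    then obtain r where r: "prime r" "r dvd nat q"
      using prime_factor_nat by blast
    have rq: "int r dvd q" using r(2) q by (metis int_nat_eq int_dvd_int_iff order_less_imp_le)
    have "int (r^2) dvd int h" using dvd_trans[OF dvd_power_same[OF rq] qh] by simp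
    then have "r^2 dvd h" by (simp only: int_dvd_int_iff)
    then have "even r" using sqf[OF r(1)] by blast
    then have "even q" using rq by (metis dvd_trans even_of_nat)
    then obtain q' where q': "q = 2 * q'" by blast
    have odd: "odd p" "odd (p - int s * q)"
      using cop \<open>even q\<close> by (auto simp: coprime_def)
    \<comment> \<open>For even \<open>q\<close> the right side \<open>18 * k * q^2\<close> is
      \<open>72 * k * q'^2\<close>, while \<open>p\<close> and \<open>p - s * q\<close> are odd, so
      8 would divide \<open>h\<close>.\<close>
    have "8 dvd int h * (p * (p - int s * q))"
      unfolding E by (simp add: q' power2_eq_square)
    moreover have "coprime ((2::int)^3) (p * (p - int s * q))"
      using odd by (subst coprime_power_left_iff) simp
    ultimately have "8 dvd int h" by (simp add: coprime_dvd_mult_left_iff)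
    then show False using not_8_dvd by presburger
  qed
  then have wp: "w = real_of_int p" and E: "int h * (p * (p - int s)) = 18 * k"
    using wpq E by simp_all
  obtain h' where h': "h = 3 * h'" using h3 by blast
  have "\<not> 3 dvd h'"
  proof
    assume "3 dvd h'"
    then have "3^2 dvd h" unfolding h' by auto
    then show False using sqf[of 3] by simp
  qed
  then have "\<not> 3 dvd int h'" by presburger
  moreover have "int h' * (p * (p - int s)) = 3 * (2 * k)" using E by (simp add: h' algebra_simps)
  then have "3 dvd int h' * (p * (p - int s))" by simp
  moreover have "prime (3::int)" by simp
  ultimately have "3 dvd p \<or> 3 dvd p - int s" by (metis prime_dvd_mult_iff)
  then show ?thesis using wp by blast
qed

text \<open>The design splits into two opposite open hemispheres. The factor 2 sharpens divisibility
  by 12 to divisibility by 24.\<close>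

lemma antipodal_half_sum:
  fixes f :: "'a::real_inner \<Rightarrow> 'b::comm_semiring_1"
  assumes fin: "finite D" and neg: "\<And>x. x \<in> D \<Longrightarrow> - x \<in> D"
    and ne: "\<And>x. x \<in> D \<Longrightarrow> x \<bullet> a \<noteq> 0" and f: "\<And>x. f (- x) = f x"
  shows "sum f D = 2 * sum f {x \<in> D. x \<bullet> a > 0}"
proof -
  let ?Y = "{x \<in> D. x \<bullet> a > 0}"
  have "x \<in> uminus ` ?Y" if "x \<in> D" "\<not> x \<bullet> a > 0" for x
    using neg[OF that(1)] ne[OF that(1)] that(2) by (intro image_eqI[of _ _ "- x"]) auto
  then have "D = ?Y \<union> uminus ` ?Y" using neg by auto
  moreover have "sum f (?Y \<union> uminus ` ?Y) = sum f ?Y + sum f (uminus ` ?Y)"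
    using fin by (intro sum.union_disjoint) auto
  moreover have "sum f (uminus ` ?Y) = sum f ?Y"
    by (subst sum.reindex) (auto simp: f)
  ultimately show ?thesis by (simp add: mult_2)
qed

text \<open>
  The design rescaled to norm \<open>s = 2 m + 1\<close>, glued to a unit vector in one further dimension (so that
  the lattice becomes unimodular at \<open>2\<close>) and divided by \<open>sqrt 2\<close>.
\<close>

definition design_gen :: "real \<Rightarrow> real^'n \<Rightarrow> real^('n option)" where
  "design_gen s x = append_coord (sqrt (s / 2) *\<^sub>R x) (1 / sqrt 2)"

lemma inner_design_gen:
  "append_coord p q \<bullet> design_gen s x = sqrt (s / 2) * (p \<bullet> x) + q / sqrt 2"
  by (simp add: design_gen_def append_coord_inner)

lemma design_gen_inner:
  assumes "s \<ge> 0"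
  shows "design_gen s x \<bullet> design_gen s y = (s * (x \<bullet> y) + 1) / 2"
  using assms by (simp add: design_gen_def append_coord_inner mult.assoc[symmetric] add_divide_distrib real_sqrt_divide)

section \<open>The lattice of the design and its dual\<close>

locale odd_tight_design =
  fixes m :: nat and D :: "(real^'n) set"
  assumes odd_m: "odd m" and m3: "\<not> [m = 1] (mod 3)"
    and sqf: "\<And>p::nat. prime p \<Longrightarrow> odd p \<Longrightarrow> \<not> p ^ 2 dvd m * (m + 1)"
    and not_8_dvd_Suc: "\<not> 8 dvd m + 1"
    and card_n: "CARD('n) = (2 * m + 1) ^ 2 - 2"
    and tight: "tight_spherical_5_design D"
begin

definition "s = 2 * m + 1"
definition "h = m * (m + 1)"
abbreviation "Z \<equiv> design_gen (real s) ` D"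
abbreviation "K \<equiv> int_span Z"

lemma m_pos: "m > 0" using odd_m by (cases m) auto
lemma s_pos: "real s > 0" by (simp add: s_def)
lemma h_pos: "h > 0" using m_pos by (simp add: h_def)

lemma card_n_real: "real CARD('n) + 1 = 4 * h" "real CARD('n) + 2 = (real s)^2"
proof -
  have "CARD('n) + 2 = (2 * m + 1) ^ 2"
    using card_n m_pos by (simp add: power2_eq_square)
  from arg_cong[OF this, of real] have "real CARD('n) + 2 = (2 * real m + 1)^2" by (simp add: add.commute)
  then show "real CARD('n) + 1 = 4 * h" "real CARD('n) + 2 = (real s)^2"
    by (simp_all add: h_def s_def power2_eq_square algebra_simps)
qed

lemma not_8_dvd: "\<not> 8 dvd h"
proof -
  have "coprime (2^3) m" using odd_m by (subst coprime_power_left_iff) simp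
  then have "coprime 8 m" by simp
  from coprime_dvd_mult_right_iff[OF this] show ?thesis using not_8_dvd_Suc unfolding h_def by blast
qed

text \<open>The residue of \<open>m\<close> modulo 3 is 0 or 2, so that of
  \<open>s = 2 * m + 1\<close> is 1 or 2.\<close>

lemma mod3_conditions: "3 dvd h" "\<not> 3 dvd s"
proof -
  have "3 dvd m \<or> 3 dvd m + 1" "\<not> 3 dvd s"
    using m3 unfolding cong_def s_def by presburger+
  then show "3 dvd h" "\<not> 3 dvd s" unfolding h_def by (blast intro: dvd_mult dvd_mult2)+
qed

lemma finite_D: "finite D" and D_nonempty: "D \<noteq> {}" and unit_D: "x \<in> D \<Longrightarrow> x \<bullet> x = 1"
  using tight by (auto simp: tight_spherical_5_design_def spherical_design_def norm_eq_1[symmetric])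

lemma uminus_D: "x \<in> D \<Longrightarrow> - x \<in> D"
  by (rule tight_design_structure(1)[OF tight])

lemma sum_squares: "(\<Sum>x\<in>D. (a \<bullet> x)^2) = 4 * h * (a \<bullet> a)"
  using tight_design_sums(1)[OF tight] card_n_real by simp

lemma sum_fourth_powers: "(\<Sum>x\<in>D. (a \<bullet> x)^4) = 12 * h / (real s)^2 * (a \<bullet> a)^2"
  using tight_design_sums(2)[OF tight] card_n_real by simp

lemma inner_cases:
  assumes "x \<in> D" "y \<in> D"
  shows "s * (x \<bullet> y) \<in> {s, - s, 1, - 1}"
proof -
  consider "y = x" | "y = - x" | "(x \<bullet> y)^2 = 1 / (real s)^2"
    using tight_design_structure(2)[OF tight assms] card_n_real by auto
  then show ?thesis
  proof cases
    case 3
    then have "(s * (x \<bullet> y))^2 = 1" using s_pos by (simp add: power_mult_distrib)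
    then show ?thesis by (auto simp: power2_eq_1_iff)
  qed (use assms unit_D in auto)
qed

text \<open>The numbers \<open>s * (x \<bullet> y)\<close> are odd; the extra coordinate adds 1
  before halving.\<close>

lemma Z_integral:
  assumes "u \<in> Z" "v \<in> Z"
  shows "u \<bullet> v \<in> \<int>"
proof -
  obtain x y where xy: "x \<in> D" "y \<in> D" "u = design_gen s x" "v = design_gen s y"
    using assms by blast
  have "u \<bullet> v = (s * (x \<bullet> y) + 1) / 2" using xy by (simp add: design_gen_inner)
  moreover have "(real s + 1) / 2 = of_nat (m + 1)" "(- real s + 1) / 2 = - of_nat m"
    by (simp_all add: s_def)
  ultimately show ?thesis
    using inner_cases[OF xy(1,2)] by (elim insertE) (auto simp del: of_nat_add)
qed

text \<open>The norm of a generator is \<open>(s + 1) / 2 = m + 1\<close>, and \<open>m\<close> is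
  odd.\<close>

lemma Z_even:
  assumes "u \<in> Z"
  shows "\<exists>z::int. u \<bullet> u = 2 * real_of_int z"
proof -
  obtain x where x: "x \<in> D" "u = design_gen s x" using assms by blast
  obtain e where e: "m = 2 * e + 1" using odd_m by (auto elim: oddE)
  have "u \<bullet> u = (real s + 1) / 2" using x unit_D by (simp add: design_gen_inner)
  also have "\<dots> = real m + 1" by (simp add: s_def)
  also have "\<dots> = 2 * real_of_int (int (e + 1))" by (simp add: e)
  finally have "u \<bullet> u = 2 * real_of_int (int (e + 1))" .
  then show ?thesis by blast
qed

text \<open>An antipodal pair isolates the extra coordinate \<open>q\<close>, and the second moment
  then forces \<open>p = 0\<close>.\<close>

lemma nondegenerate:
  assumes "\<And>z. z \<in> Z \<Longrightarrow> u \<bullet> z = 0"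
  shows "u = 0"
proof -
  obtain p q where u: "u = append_coord p q" by (rule append_coord_cases)
  have 0: "sqrt (s / 2) * (p \<bullet> x) + q / sqrt 2 = 0" if "x \<in> D" for x
    using assms[of "design_gen s x"] that by (simp add: u inner_design_gen)
  obtain x0 where "x0 \<in> D" using D_nonempty by blast
  then have q: "q = 0" using 0[of x0] 0[of "- x0"] uminus_D s_pos by auto
  then have "p \<bullet> x = 0" if "x \<in> D" for x using 0[OF that] s_pos by simp
  then have "4 * h * (p \<bullet> p) = 0" using sum_squares[of p] by simp
  then have "p = 0" using h_pos by simp
  then show ?thesis using q by (simp add: u append_coord_eq_0_iff)
qed

sublocale integral_lattice K
  by (rule integral_lattice_int_span) (use nondegenerate Z_integral in auto)

text \<open>The sum of \<open>t^4 - t^2\<close> over the design is a multiple of 24; the second and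
  fourth moments turn this into \<open>h * w * (w - s) = 18 * k\<close>.\<close>

lemma scaled_norm_of_integral_functional:
  assumes int: "\<And>x. x \<in> D \<Longrightarrow> \<beta> \<bullet> x \<in> \<int>"
  shows "\<exists>z::int. 3 * (\<beta> \<bullet> \<beta>) / s = z \<and> ((3::int) dvd z \<or> (3::int) dvd z - int s)"
proof -
  define w where "w = 3 * (\<beta> \<bullet> \<beta>) / s"
  have bb: "\<beta> \<bullet> \<beta> = s * w / 3" using s_pos by (simp add: w_def)
  define t where "t x = \<lfloor>\<beta> \<bullet> x\<rfloor>" for x
  have t: "\<beta> \<bullet> x = of_int (t x)" if "x \<in> D" for x using int[OF that] by (simp add: t_def)
  \<comment> \<open>Integrality of the second moment makes \<open>w\<close> rational, as needed for
    writing it in lowest terms.\<close>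
  have "(\<Sum>x\<in>D. (\<beta> \<bullet> x)^2) \<in> \<int>" using int by (intro Ints_sum Ints_power)
  then have "4 * h * (s * w / 3) \<in> \<int>" by (simp only: sum_squares bb)
  then obtain N where "4 * h * (s * w / 3) = real_of_int N" by (auto elim: Ints_cases)
  then have "w = of_int (3 * N) / of_nat (4 * h * s)"
    using h_pos s_pos by (simp add: field_simps)
  then have rat: "w \<in> \<rat>" by (metis Rats_divide Rats_of_int Rats_of_nat)
  obtain x0 where x0: "x0 \<in> D" using D_nonempty by blast
  let ?Y = "{x \<in> D. x \<bullet> x0 > 0}"
  have "12 dvd (\<Sum>x\<in>?Y. t x ^ 4 - t x ^ 2)"
    by (intro dvd_sum twelve_dvd_power4_minus_square)
  then obtain k where k: "(\<Sum>x\<in>?Y. t x ^ 4 - t x ^ 2) = 12 * k" by blast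
  have "(\<Sum>x\<in>D. (\<beta> \<bullet> x)^4 - (\<beta> \<bullet> x)^2) = 2 * (\<Sum>x\<in>?Y. (\<beta> \<bullet> x)^4 - (\<beta> \<bullet> x)^2)"
  proof (rule antipodal_half_sum[OF finite_D uminus_D])
    show "x \<bullet> x0 \<noteq> 0" if "x \<in> D" for x
      using inner_cases[OF that x0] s_pos by auto
  qed auto
  also have "(\<Sum>x\<in>?Y. (\<beta> \<bullet> x)^4 - (\<beta> \<bullet> x)^2) = real_of_int (\<Sum>x\<in>?Y. t x ^ 4 - t x ^ 2)"
    by (simp add: t)
  also have "\<dots> = 12 * real_of_int k" by (simp only: k of_int_mult of_int_numeral)
  finally have "12 * h / (real s)^2 * (s * w / 3)^2 - 4 * h * (s * w / 3) = 24 * k"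
    unfolding sum_subtractf sum_squares sum_fourth_powers bb by simp
  moreover have "12 * h / (real s)^2 * (s * w / 3)^2 = 4 * h * w^2 / 3"
    using s_pos by (simp add: power2_eq_square)
  ultimately have "h * w * (w - s) = 18 * real_of_int k"
    by (simp add: power2_eq_square algebra_simps)
  then show ?thesis
    unfolding w_def[symmetric]
    by (rule integrality_of_scaled_norm[OF rat _ not_8_dvd mod3_conditions(1)]) (use sqf in \<open>simp add: h_def\<close>)
qed

text \<open>The parity condition makes \<open>q / sqrt 2\<close> an integer \<open>c\<close>, so
  \<open>sqrt (s / 2) *\<^sub>R p\<close> has integral values on \<open>D\<close>. The extra
  coordinate contributes \<open>3 * c^2\<close>, which is 0 modulo 3.\<close>

lemma dual_norm_even:
  assumes u: "append_coord p q \<in> dual_lattice K" and q: "sqrt 2 * q = 2 * real_of_int c"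
  shows "\<exists>z::int. 3 * (append_coord p q \<bullet> append_coord p q) / 2 = z
    \<and> ((3::int) dvd z \<or> (3::int) dvd z - int s)"
proof -
  define \<beta> where "\<beta> = sqrt (s / 2) *\<^sub>R p"
  have q': "q / sqrt 2 = c" "q * q = 2 * c^2"
  proof -
    have "2 * q = sqrt 2 * (sqrt 2 * q)" by (simp add: mult.assoc[symmetric])
    also have "\<dots> = 2 * (sqrt 2 * c)" by (simp add: q)
    finally have "q = sqrt 2 * c" by simp
    then show "q / sqrt 2 = c" "q * q = 2 * c^2" by (simp_all add: power2_eq_square)
  qed
  have "\<beta> \<bullet> x \<in> \<int>" if "x \<in> D" for x
  proof -
    have "\<beta> \<bullet> x + c \<in> \<int>"
      using u that by (auto simp: dual_lattice_int_span inner_design_gen \<beta>_def q'[symmetric])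
    from Ints_diff[OF this Ints_of_int[of c]] show ?thesis by simp
  qed
  then obtain z :: int where z: "3 * (\<beta> \<bullet> \<beta>) / s = z" "(3::int) dvd z \<or> (3::int) dvd z - int s"
    using scaled_norm_of_integral_functional by blast
  have bb: "\<beta> \<bullet> \<beta> = s / 2 * (p \<bullet> p)" using s_pos by (simp add: \<beta>_def mult.assoc[symmetric])
  have "3 * (\<beta> \<bullet> \<beta>) / s = 3 * (p \<bullet> p) / 2" unfolding bb using s_pos by simp
  then have "3 * (p \<bullet> p) / 2 = z" using z(1) by simp
  then have "3 * (append_coord p q \<bullet> append_coord p q) / 2 = real_of_int (z + 3 * c^2)"
    by (simp add: append_coord_inner q')
  moreover have "(3::int) dvd z + 3 * c^2 \<or> (3::int) dvd z + 3 * c^2 - int s"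
    using z(2) by presburger
  ultimately show ?thesis by blast
qed

text \<open>Pairing \<open>u\<close> with the generators of an antipodal pair shows that
  \<open>sqrt 2 * q\<close> is an integer. If it is odd, subtracting one generator makes it even and
  changes \<open>3 * (u \<bullet> u) / 2\<close> by a multiple of 3.\<close>

lemma dual_norm:
  assumes u: "u \<in> dual_lattice K"
  shows "\<exists>z::int. 3 * (u \<bullet> u) / 2 = z \<and> ((3::int) dvd z \<or> (3::int) dvd z - int s)"
proof -
  obtain p q where pq: "u = append_coord p q" by (rule append_coord_cases)
  obtain x0 where x0: "x0 \<in> D" using D_nonempty by blast
  let ?z = "design_gen s x0"
  have "u \<bullet> ?z + u \<bullet> design_gen s (- x0) \<in> \<int>"
    using u x0 uminus_D by (intro Ints_add) (auto simp: dual_lattice_int_span)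
  then have "2 * (q / sqrt 2) \<in> \<int>" by (simp add: pq inner_design_gen)
  moreover have "2 * (q / sqrt 2) = sqrt 2 * q" by (simp add: field_simps)
  ultimately obtain a where a: "sqrt 2 * q = of_int a" by (auto elim: Ints_cases)
  show ?thesis
  proof (cases "even a")
    case True
    then obtain c where "a = 2 * c" by blast
    then show ?thesis using dual_norm_even[of p q c] u a by (simp add: pq)
  next
    case False
    then obtain c where c: "a = 2 * c + 1" by (auto elim: oddE)
    define v where "v = u - ?z"
    have zK: "?z \<in> K" using x0 by (intro int_span_base) auto
    have vL: "v \<in> dual_lattice K"
      using u integral[OF zK] by (auto simp: v_def dual_lattice_def inner_diff_left)
    moreover have v: "v = append_coord (p - sqrt (s / 2) *\<^sub>R x0) (q - 1 / sqrt 2)"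
      by (simp add: v_def pq design_gen_def append_coord_diff)
    moreover have "sqrt 2 * (q - 1 / sqrt 2) = 2 * real_of_int c"
      using a c by (simp add: right_diff_distrib)
    ultimately obtain z' :: int where z': "3 * (v \<bullet> v) / 2 = z'" "(3::int) dvd z' \<or> (3::int) dvd z' - int s"
      using dual_norm_even by metis
    obtain k where k: "v \<bullet> ?z = of_int k"
      using vL zK by (auto simp: dual_lattice_def elim: Ints_cases)
    obtain e where e: "?z \<bullet> ?z = 2 * real_of_int e" using Z_even x0 by blast
    have "u = v + ?z" by (simp add: v_def)
    then have "u \<bullet> u = v \<bullet> v + 2 * (v \<bullet> ?z) + ?z \<bullet> ?z"
      by (simp add: inner_add_left inner_add_right inner_commute)
    then have "3 * (u \<bullet> u) / 2 = real_of_int (z' + 3 * k + 3 * e)"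
      using z'(1) k e by simp
    moreover have "(3::int) dvd z' + 3 * k + 3 * e \<or> (3::int) dvd z' + 3 * k + 3 * e - int s"
      using z'(2) by presburger
    ultimately show ?thesis by blast
  qed
qed

lemma unimodular: "dual_lattice K \<subseteq> K"
proof (rule dual_subset_of_three_modular[of "int s"])
  have "real CARD('n option) = real (4 * h)" using card_n_real(1) by simp
  then show "4 dvd CARD('n option)" by (simp only: of_nat_eq_iff) simp
  show "\<exists>z::int. v \<bullet> v = 2 * z" if "v \<in> K" for v
    using int_span_even[OF that Z_integral Z_even] .
  show "\<not> 3 dvd int s" using mod3_conditions(2) by presburger
qed (rule dual_norm)

text \<open>Values in \<open>{0, 1, - 1}\<close> equate the second and fourth power sums, which
  fixes \<open>3 * (\<gamma> \<bullet> \<gamma>) = s^2\<close>. The associated dual vector then has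
  norm \<open>2 * s / 3\<close>, although it lies in the integral lattice \<open>K\<close>.\<close>

lemma not_minimal_type: "\<not> minimal_type D"
proof
  assume "minimal_type D"
  then obtain \<gamma> where \<gamma>: "\<gamma> \<noteq> 0" "\<And>x. x \<in> D \<Longrightarrow> \<gamma> \<bullet> x \<in> {0, 1, - 1}"
    by (auto simp: minimal_type_def)
  have "(\<Sum>x\<in>D. (\<gamma> \<bullet> x)^4) = (\<Sum>x\<in>D. (\<gamma> \<bullet> x)^2)"
    using \<gamma>(2) by (intro sum.cong) fastforce+
  then have "12 * h / (real s)^2 * (\<gamma> \<bullet> \<gamma>)^2 = 4 * h * (\<gamma> \<bullet> \<gamma>)"
    by (simp only: sum_squares sum_fourth_powers)
  then have norm: "3 * (\<gamma> \<bullet> \<gamma>) = (real s)^2"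
    using h_pos s_pos \<gamma>(1) by (simp add: field_simps power2_eq_square)
  \<comment> \<open>The factor \<open>sqrt (2 / s)\<close> cancels the scaling
    \<open>sqrt (s / 2)\<close> of the generators, so \<open>u\<close> has the same products with
    them as \<gamma> has with the design.\<close>
  define u where "u = append_coord (sqrt (2 / s) *\<^sub>R \<gamma>) 0"
  have "u \<bullet> design_gen s x = \<gamma> \<bullet> x" for x
    using s_pos by (simp add: u_def inner_design_gen mult.assoc[symmetric] real_sqrt_mult[symmetric])
  then have "u \<in> dual_lattice K" using \<gamma>(2) by (force simp: dual_lattice_int_span)
  then have "u \<in> K" using unimodular by blast
  then have "u \<bullet> u \<in> \<int>" using integral by blast
  moreover have "u \<bullet> u = 2 / s * (\<gamma> \<bullet> \<gamma>)"
    using s_pos by (simp add: u_def append_coord_inner mult.assoc[symmetric])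
  then have "3 * (u \<bullet> u) = 2 / s * (3 * (\<gamma> \<bullet> \<gamma>))" by simp
  then have "3 * (u \<bullet> u) = real (2 * s)"
    unfolding norm using s_pos by (simp add: power2_eq_square)
  ultimately obtain z where "real_of_int (3 * z) = real_of_int (int (2 * s))" by (auto elim: Ints_cases)
  then have "3 * z = int (2 * s)" by (simp only: of_int_eq_iff)
  then show False using mod3_conditions(2) by presburger
qed

end

theorem theorem3p6:
  fixes m :: nat and D :: "(real ^ 'n) set"
  assumes "odd m" and "m > 0" and "\<not> [m = 1] (mod 3)"
    and "\<And>p::nat. prime p \<Longrightarrow> odd p \<Longrightarrow> \<not> p ^ 2 dvd m * (m + 1)"
    and "\<not> 8 dvd m + 1"
    and "CARD('n) = (2 * m + 1) ^ 2 - 2"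
    and "tight_spherical_5_design D"
  shows "\<not> minimal_type D"
proof -
  interpret odd_tight_design m D
    by unfold_locales (use assms in auto)
  show ?thesis by (rule not_minimal_type)
qed

end
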